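(* Let $d\geqslant 1$ be an integer and let $T_1,\dots,T_d$ be rooted trees of height $\omega$, without isolated branches, in which every node has at least one but at most countably many immediate successors. Let $A$ be a finite set with the discrete topology and let $f:\bigcup_{l\in\omega}\bigl(T_1(l)\times\cdots\times T_d(l)\bigr)\to A$ be a function. Let $F_0$ be an $F_\sigma$ filter over $\omega$, and for each $i\in\{1,\dots,d\}$ let $M_i$ be a subset of $[T_i]$ of the first category in $[T_i]$. Then there exist sets $D_1,\dots,D_d$, with $D_i$ dense in $[T_i]$ for each $i$, and an $F_\sigma$ filter $F\supseteq F_0$ over $\omega$, such that $D_i\cap M_i=\emptyset$ for each $i$, and such that the rule $$g(b_1,\dots,b_d)=a\quad\Leftrightarrow\quad\{n\in\omega\,|\,f(b_1(n),\dots,b_d(n))=a\}\in F$$ (for $b_1\in D_1,\dots,b_d\in D_d$, $a\in A$) defines a mapping $g:D_1\times\cdots\times D_d\to A$ (that is, for every $\langle b_1,\dots,b_d\rangle\in D_1\times\cdots\times D_d$ there is exactly one such $a\in A$), and this mapping $g$ is continuous. If $F_0$ is a countably generated filter, then $F$ can be chosen to be countably generated. Moreover, $F$ can be chosen to be a filter generated by $F_0\cup S$ for some countable set $S$ (of subsets of $\omega$).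
   Context: For a rooted tree $T$ of height $\omega$ (every node is at a finite height), $T(l)$ denotes the set of nodes at height $l$. $[T]$ denotes the set of all (infinite) branches of $T$, and for a branch $b\in[T]$ and $n\in\omega$, $b(n)$ denotes the node of $b$ at height $n$. The set $[T]$ carries the usual tree topology, whose basic open sets are the sets of all branches passing through a given node. A tree has no isolated branches if $[T]$ has no isolated points in this topology. The set $D_1\times\cdots\times D_d$ carries the subspace topology from the product $[T_1]\times\cdots\times[T_d]$. Filters over $\omega$ are proper filters of subsets of $\omega$. The power set $\mathcal P(\omega)$ is identified with ${}^\omega 2$ via characteristic functions and given the product topology. An $F_\sigma$ filter is a filter over $\omega$ which is a countable union of closed subsets of $\mathcal P(\omega)$. A filter is countably generated if it is generated, as a filter, by a countable family of subsets of $\omega$. *)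

theory Defs
  imports "HOL-Analysis.Analysis"
begin

text \<open>A tree is given by its reflexive order \<open>r\<close>; its set of nodes is \<open>Field r\<close>, and
  \<open>underS r x\<close> is the set of strict predecessors of \<open>x\<close>. Since these sets will be finite
  chains, the height of \<open>x\<close> is the cardinality of \<open>underS r x\<close>.\<close>

definition tree_level :: "'a rel \<Rightarrow> nat \<Rightarrow> 'a set" where
  "tree_level r l = {x \<in> Field r. card (underS r x) = l}"

definition rooted_omega_tree :: "'a rel \<Rightarrow> bool" where
  "rooted_omega_tree r \<longleftrightarrow>
     Partial_order r \<and>
     (\<exists>root\<in>Field r. \<forall>x\<in>Field r. (root, x) \<in> r) \<and>
     (\<forall>x\<in>Field r. finite (underS r x) \<and> total_on (underS r x) r) \<and>
     (\<forall>l. tree_level r l \<noteq> {})"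

definition immediate_successors :: "'a rel \<Rightarrow> 'a \<Rightarrow> 'a set" where
  "immediate_successors r x =
     {y. x \<in> underS r y \<and> (\<forall>z. x \<in> underS r z \<longrightarrow> z \<notin> underS r y)}"

text \<open>Infinite branches are the infinite maximal chains.\<close>

definition branches :: "'a rel \<Rightarrow> 'a set set" where
  "branches r = {b \<in> Chains r. infinite b \<and> (\<forall>c\<in>Chains r. b \<subseteq> c \<longrightarrow> c = b)}"

definition branch_node :: "'a rel \<Rightarrow> 'a set \<Rightarrow> nat \<Rightarrow> 'a" where
  "branch_node r b n = (THE x. x \<in> b \<and> x \<in> tree_level r n)"

text \<open>The generating sets are closed under intersection up to the empty set,
  so they form a base and not only a subbase.\<close>

definition branch_topology :: "'a rel \<Rightarrow> 'a set topology" where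
  "branch_topology r = topology_generated_by {{b \<in> branches r. x \<in> b} |x. x \<in> Field r}"

definition no_isolated_branches :: "'a rel \<Rightarrow> bool" where
  "no_isolated_branches r \<longleftrightarrow> (\<forall>b\<in>branches r. \<not> openin (branch_topology r) {b})"

definition dense_in :: "'a topology \<Rightarrow> 'a set \<Rightarrow> bool" where
  "dense_in X D \<longleftrightarrow> D \<subseteq> topspace X \<and> X closure_of D = topspace X"

definition nowhere_dense_in :: "'a topology \<Rightarrow> 'a set \<Rightarrow> bool" where
  "nowhere_dense_in X N \<longleftrightarrow> N \<subseteq> topspace X \<and> X interior_of (X closure_of N) = {}"

definition first_category_in :: "'a topology \<Rightarrow> 'a set \<Rightarrow> bool" where
  "first_category_in X M \<longleftrightarrow>
     (\<exists>N :: nat \<Rightarrow> 'a set. (\<forall>n. nowhere_dense_in X (N n)) \<and> M = (\<Union>n. N n))"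

text \<open>The library type \<open>nat filter\<close> includes the improper filter \<open>bot\<close>, and its order is
  reverse inclusion: \<open>F \<le> F\<^sub>0\<close> says that every set in \<open>F\<^sub>0\<close> is in \<open>F\<close>. Membership of a set
  in \<open>F\<close> means \<open>eventually\<close> of its characteristic function, so a filter is identified with
  the set of those characteristic functions.\<close>

definition fsigma_filter :: "nat filter \<Rightarrow> bool" where
  "fsigma_filter F \<longleftrightarrow>
     F \<noteq> bot \<and>
     fsigma_in (product_topology (\<lambda>_. discrete_topology (UNIV :: bool set)) (UNIV :: nat set))
       {P. eventually P F}"

text \<open>The infimum of principal filters is the smallest filter, as a family of sets,
  that contains all members of \<open>G\<close>.\<close>

definition filter_generated_by :: "nat set set \<Rightarrow> nat filter" where
  "filter_generated_by G = (INF X\<in>G. principal X)"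

end

theory Submission
  imports Defs
begin

text \<open>
  The core is a level-free Halpern-Laeuchli theorem for countable preorders: a finite colouring of a
  finite product has a tuple \<open>s\<close> and a colour \<open>a\<close> such that every finite family above \<open>s\<close> is dominated
  by one whose product is coloured \<open>a\<close>. It is proved by induction on the number of factors. By
  compactness, every nonempty closed set of colourings that is invariant under raising coordinates
  contains a colouring that is constant on the cones of a dense set; applied to the raised copies of
  a given colouring, this makes the colour of finitely many tuples stable under further raising, so
  the elements of a finite set in the new coordinate can be treated one after the other.

  For the theorem itself the closed invariant set consists of the colourings of node tuples whose
  finite restrictions can be copied by \<open>f\<close> onto sets of levels that are positive for the compact
  pieces of the \<open>F\<^sub>\<sigma>\<close> filter. A locally constant member of this set gives the continuous limit, and a
  fusion of countably many branches through all nodes realizes it. The filter is extended by the sets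
  of levels on which the tuples of these branches have their limit colour.
\<close>

section \<open>A Halpern-Laeuchli theorem for countable preorders\<close>

text \<open>A tuple of nodes at different heights has no colour under \<open>f\<close>, and cutting
  it down to a common level gives colours that vary with the level. So the limit colour of a tuple
  is not read off from \<open>f\<close>; it is prescribed by a second colouring \<open>c\<close> of
  all node tuples, tied to \<open>f\<close> only through \<open>realizes\<close>. Levels then
  disappear from the combinatorics, which is why a partition theorem for plain preorders is enough.
  The F_sigma hypothesis enters through compactness. All members of a closed subset of a proper
  filter meet one finite window of levels. Nodes can be raised above that window in advance, and
  then every level of the window carries one of finitely many colour patterns. Finite meets of
  members of closed pieces stay in a closed piece, so not every pattern can be refuted. At each
  stage of the fusion only one closed piece has to be served, and the pieces increase to the whole
  filter.\<close>

lemma infinite_natE: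
  assumes "infinite {n :: nat. P n}"
  obtains n where "n \<ge> m" "P n"
  using assms infinite_nat_iff_unbounded_le[of "{n. P n}"] by blast

text \<open>Compactness of the space of colourings, in the form of a cluster point. Nested infinite
  index sets make the colours constant one element of \<open>B\<close> at a time; a finite
  \<open>G\<close> involves only finitely many of these sets, so no diagonal subsequence is
  needed.\<close>

lemma colouring_limit:
  fixes c :: "nat \<Rightarrow> 'b \<Rightarrow> 'c"
  assumes "countable B" "finite A" and c: "\<And>n. c n \<in> B \<rightarrow> A"
  shows "\<exists>e\<in>B \<rightarrow> A. \<forall>G. finite G \<longrightarrow> G \<subseteq> B \<longrightarrow> infinite {n. \<forall>x\<in>G. c n x = e x}"
proof (cases "B = {}")
  case True
  then show ?thesis by auto
next
  case False
  define x where "x = from_nat_into B"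
  have xB: "x k \<in> B" for k
    using False by (simp add: x_def from_nat_into)
  have "\<exists>S :: nat \<Rightarrow> nat set. \<forall>k. infinite (S k) \<and> S (Suc k) \<subseteq> S k \<and>
      (\<exists>a. \<forall>n\<in>S (Suc k). c n (x k) = a)"
  proof (rule dependent_nat_choice)
    show "\<exists>S :: nat set. infinite S" by blast
  next
    fix S :: "nat set" and k assume S: "infinite S"
    have "(\<lambda>n. c n (x k)) ` S \<subseteq> A" using c xB by fastforce
    then have "finite ((\<lambda>n. c n (x k)) ` S)" using \<open>finite A\<close> finite_subset by blast
    from pigeonhole_infinite[OF S this] obtain m where
      "infinite {n \<in> S. c n (x k) = c m (x k)}" by blast
    then show "\<exists>S'. infinite S' \<and> S' \<subseteq> S \<and> (\<exists>a. \<forall>n\<in>S'. c n (x k) = a)"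
      by (intro exI[of _ "{n \<in> S. c n (x k) = c m (x k)}"]) auto
  qed
  then obtain S a where S: "\<And>k. infinite (S k)" "\<And>k. S (Suc k) \<subseteq> S k"
    and a: "\<And>k n. n \<in> S (Suc k) \<Longrightarrow> c n (x k) = a k"
    by metis
  define e where "e y = a (to_nat_on B y)" for y
  have dec: "S k \<subseteq> S l" if "l \<le> k" for k l
    using lift_Suc_antimono_le[of S, OF S(2) that] .
  have ae: "c n y = e y" if "y \<in> B" "n \<in> S (Suc (to_nat_on B y))" for n y
    using a[OF that(2)] that(1) \<open>countable B\<close> by (simp add: x_def e_def)
  show ?thesis
  proof (intro bexI allI impI)
    show "e \<in> B \<rightarrow> A"
    proof
      fix y assume y: "y \<in> B"
      obtain n where "n \<in> S (Suc (to_nat_on B y))"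
        using S(1) by (metis finite.emptyI ex_in_conv)
      with ae[OF y] c[of n] y show "e y \<in> A" by (metis PiE)
    qed
    fix G assume G: "finite G" "G \<subseteq> B"
    obtain m where m: "\<And>y. y \<in> G \<Longrightarrow> Suc (to_nat_on B y) \<le> m"
      using finite_nat_set_iff_bounded_le[of "(\<lambda>y. Suc (to_nat_on B y)) ` G"] G(1) by auto
    have "S m \<subseteq> {n. \<forall>y\<in>G. c n y = e y}"
      using ae G(2) dec[OF m] by blast
    then show "infinite {n. \<forall>x\<in>G. c n x = e x}"
      using S(1) infinite_super by blast
  qed
qed

section \<open>Products of preorders and coordinatewise raising\<close>

definition preorders :: "'i set \<Rightarrow> ('i \<Rightarrow> 'a set) \<Rightarrow> ('i \<Rightarrow> 'a \<Rightarrow> 'a \<Rightarrow> bool) \<Rightarrow> bool" where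
  "preorders I C le \<longleftrightarrow> (\<forall>i\<in>I. C i \<noteq> {} \<and> countable (C i) \<and> (\<forall>x\<in>C i. le i x x) \<and>
     (\<forall>x\<in>C i. \<forall>y\<in>C i. \<forall>z\<in>C i. le i x y \<longrightarrow> le i y z \<longrightarrow> le i x z))"

definition upper_cone :: "('i \<Rightarrow> 'a set) \<Rightarrow> ('i \<Rightarrow> 'a \<Rightarrow> 'a \<Rightarrow> bool) \<Rightarrow> ('i \<Rightarrow> 'a) \<Rightarrow> 'i \<Rightarrow> 'a set" where
  "upper_cone C le s i = {x \<in> C i. le i (s i) x}"

text \<open>One map for each coordinate and not one map on tuples: tuples that share an element in
  some coordinate still share it after raising. This coupling is the difficulty of the partition
  theorem.\<close>

definition inflations :: "'i set \<Rightarrow> ('i \<Rightarrow> 'a set) \<Rightarrow> ('i \<Rightarrow> 'a \<Rightarrow> 'a \<Rightarrow> bool) \<Rightarrow> ('i \<Rightarrow> 'a \<Rightarrow> 'a) set" where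
  "inflations I C le = {\<phi>. \<forall>i\<in>I. \<forall>p\<in>C i. \<phi> i p \<in> C i \<and> le i p (\<phi> i p)}"

definition app :: "'i set \<Rightarrow> ('i \<Rightarrow> 'a \<Rightarrow> 'a) \<Rightarrow> ('i \<Rightarrow> 'a) \<Rightarrow> 'i \<Rightarrow> 'a" where
  "app I \<phi> q = (\<lambda>i\<in>I. \<phi> i (q i))"

definition finite_family :: "'i set \<Rightarrow> ('i \<Rightarrow> 'a set) \<Rightarrow> ('i \<Rightarrow> 'a set) \<Rightarrow> bool" where
  "finite_family I C P \<longleftrightarrow> (\<forall>i\<in>I. finite (P i) \<and> P i \<subseteq> C i)"

text \<open>Applying an inflation to a finite family is choosing one dominating element for each of its
  members, so this is the dense set form of the Halpern-Laeuchli theorem without levels.\<close>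

definition HL :: "'i set \<Rightarrow> ('i \<Rightarrow> 'a set) \<Rightarrow> ('i \<Rightarrow> 'a \<Rightarrow> 'a \<Rightarrow> bool) \<Rightarrow> 'c set \<Rightarrow> bool" where
  "HL I C le A \<longleftrightarrow> (\<forall>c \<in> PiE I C \<rightarrow> A. \<exists>s\<in>PiE I C. \<exists>a\<in>A. \<forall>P. finite_family I (upper_cone C le s) P \<longrightarrow>
     (\<exists>\<phi>\<in>inflations I C le. \<forall>q\<in>PiE I P. c (app I \<phi> q) = a))"

lemma preorders_refl: "preorders I C le \<Longrightarrow> i \<in> I \<Longrightarrow> x \<in> C i \<Longrightarrow> le i x x"
  unfolding preorders_def by blast

lemma preorders_nonempty: "preorders I C le \<Longrightarrow> i \<in> I \<Longrightarrow> C i \<noteq> {}"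
  unfolding preorders_def by blast

lemma preorders_countable: "preorders I C le \<Longrightarrow> i \<in> I \<Longrightarrow> countable (C i)"
  unfolding preorders_def by blast

lemma preorders_trans:
  "preorders I C le \<Longrightarrow> i \<in> I \<Longrightarrow> x \<in> C i \<Longrightarrow> y \<in> C i \<Longrightarrow> z \<in> C i \<Longrightarrow> le i x y \<Longrightarrow> le i y z \<Longrightarrow> le i x z"
  unfolding preorders_def by blast

lemma preorders_upper_cone:
  assumes "preorders I C le" "s \<in> PiE I C"
  shows "preorders I (upper_cone C le s) le"
proof -
  have "s i \<in> upper_cone C le s i" if "i \<in> I" for i
    using assms(2) that preorders_refl[OF assms(1)] by (auto simp: upper_cone_def)
  moreover have "countable (upper_cone C le s i)" if "i \<in> I" for i
    using preorders_countable[OF assms(1) that] by (rule countable_subset[rotated]) (auto simp: upper_cone_def)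
  moreover have "upper_cone C le s i \<subseteq> C i" for i by (auto simp: upper_cone_def)
  ultimately show ?thesis
    using assms(1) unfolding preorders_def by blast
qed

lemma countable_PiE_preorders:
  "finite I \<Longrightarrow> preorders I C le \<Longrightarrow> countable (PiE I C)"
  by (intro countable_PiE) (auto dest: preorders_countable)

lemma app_in: "\<phi> \<in> inflations I C le \<Longrightarrow> q \<in> PiE I C \<Longrightarrow> app I \<phi> q \<in> PiE I C"
  by (auto simp: inflations_def app_def PiE_mem)

lemma app_ge: "\<phi> \<in> inflations I C le \<Longrightarrow> q \<in> PiE I C \<Longrightarrow> i \<in> I \<Longrightarrow> le i (q i) (app I \<phi> q i)"
  by (auto simp: inflations_def app_def PiE_mem)

lemma id_inflation: "preorders I C le \<Longrightarrow> (\<lambda>i x. x) \<in> inflations I C le"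
  by (auto simp: inflations_def dest: preorders_refl)

lemma app_id: "q \<in> PiE I C \<Longrightarrow> app I (\<lambda>i x. x) q = q"
  unfolding app_def by (metis PiE_restrict restrict_ext)

lemma inflations_comp:
  assumes "preorders I C le" "\<phi> \<in> inflations I C le" "\<psi> \<in> inflations I C le"
  shows "(\<lambda>i x. \<psi> i (\<phi> i x)) \<in> inflations I C le"
  using assms unfolding inflations_def preorders_def by (simp, meson)

lemma app_comp: "app I (\<lambda>i x. \<psi> i (\<phi> i x)) q = app I \<psi> (app I \<phi> q)"
  by (auto simp: app_def)

lemma finite_family_mono: "finite_family I C P \<Longrightarrow> PiE I P \<subseteq> PiE I C"
  unfolding finite_family_def by (intro PiE_mono) auto

lemma finite_family_PiE: "finite I \<Longrightarrow> finite_family I C P \<Longrightarrow> finite (PiE I P)"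
  by (intro finite_PiE) (auto simp: finite_family_def)

definition exhaustion :: "('i \<Rightarrow> 'a set) \<Rightarrow> nat \<Rightarrow> 'i \<Rightarrow> 'a set" where
  "exhaustion C n i = from_nat_into (C i) ` {..n}"

lemma exhaustion_finite_family:
  "preorders I C le \<Longrightarrow> finite_family I C (exhaustion C n)"
  unfolding finite_family_def exhaustion_def by (auto intro: from_nat_into dest: preorders_nonempty)

lemma exhaustion_covers:
  assumes "finite I" "preorders I C le" "finite G" "G \<subseteq> PiE I C"
  obtains m where "\<And>n. n \<ge> m \<Longrightarrow> G \<subseteq> PiE I (exhaustion C n)"
proof -
  let ?K = "(\<lambda>(x, i). to_nat_on (C i) (x i)) ` (G \<times> I)"
  have "finite ?K" using assms by blast
  then obtain m where m: "\<forall>k\<in>?K. k \<le> m" using finite_nat_set_iff_bounded_le by blast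
  show ?thesis
  proof (rule that, rule subsetI)
    fix n x assume n: "n \<ge> m" and x: "x \<in> G"
    show "x \<in> PiE I (exhaustion C n)"
    proof (rule PiE_I)
      fix i assume i: "i \<in> I"
      have "x i \<in> C i" using x i assms(4) by auto
      moreover have "countable (C i)" using preorders_countable[OF assms(2) i] .
      ultimately have "x i = from_nat_into (C i) (to_nat_on (C i) (x i))" by simp
      moreover have "to_nat_on (C i) (x i) \<le> n" using m n x i by force
      ultimately show "x i \<in> exhaustion C n i" unfolding exhaustion_def by blast
    qed (use x assms in auto)
  qed
qed

text \<open>Coordinates of different tuples may coincide; moving such a common coordinate further up
  is harmless because \<open>U\<close> is upward closed.\<close>

lemma inflate_into_dense:
  assumes pre: "preorders I C le" and "finite G" "G \<subseteq> PiE I C"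
    and up: "\<And>x y. x \<in> U \<Longrightarrow> y \<in> PiE I C \<Longrightarrow> (\<And>i. i \<in> I \<Longrightarrow> le i (x i) (y i)) \<Longrightarrow> y \<in> U"
    and dense: "\<And>x. x \<in> PiE I C \<Longrightarrow> \<exists>y\<in>PiE I C \<inter> U. \<forall>i\<in>I. le i (x i) (y i)"
  shows "\<exists>\<phi>\<in>inflations I C le. \<forall>q\<in>G. app I \<phi> q \<in> U"
  using \<open>finite G\<close> \<open>G \<subseteq> PiE I C\<close>
proof (induction rule: finite_induct)
  case empty
  then show ?case using id_inflation[OF pre] by blast
next
  case (insert q G)
  then obtain \<phi> where \<phi>: "\<phi> \<in> inflations I C le" "\<And>q. q \<in> G \<Longrightarrow> app I \<phi> q \<in> U" by auto
  have q: "q \<in> PiE I C" using insert by auto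
  obtain y where y: "y \<in> PiE I C" "y \<in> U" "\<And>i. i \<in> I \<Longrightarrow> le i (app I \<phi> q i) (y i)"
    using dense[OF app_in[OF \<phi>(1) q]] by blast
  define \<psi> where "\<psi> i p = (if p = q i then y i else \<phi> i p)" for i p
  have yC: "y i \<in> C i" if "i \<in> I" for i using y(1) that by auto
  have \<phi>C: "\<phi> i p \<in> C i" "le i p (\<phi> i p)" if "i \<in> I" "p \<in> C i" for i p
    using \<phi>(1) that by (auto simp: inflations_def)
  have \<phi>\<psi>: "le i (\<phi> i p) (\<psi> i p)" if "i \<in> I" "p \<in> C i" for i p
    using y(3)[OF that(1)] that preorders_refl[OF pre] \<phi>C by (auto simp: \<psi>_def app_def)
  have \<psi>: "\<psi> \<in> inflations I C le"
    unfolding inflations_def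
  proof (intro CollectI ballI conjI)
    fix i p assume i: "i \<in> I" and p: "p \<in> C i"
    show "\<psi> i p \<in> C i" using \<phi>C yC i p by (auto simp: \<psi>_def)
    then show "le i p (\<psi> i p)"
      using preorders_trans[OF pre i p \<phi>C(1)[OF i p] _ \<phi>C(2)[OF i p] \<phi>\<psi>[OF i p]] by blast
  qed
  have "app I \<psi> r \<in> U" if r: "r \<in> insert q G" for r
  proof (cases "r = q")
    case True
    have "app I \<psi> q = y" using y(1) by (auto simp: app_def \<psi>_def fun_eq_iff)
    then show ?thesis using y True by simp
  next
    case False
    then have "app I \<phi> r \<in> U" "r \<in> PiE I C" using r \<phi>(2) insert.prems by auto
    then show ?thesis
      using up[of "app I \<phi> r" "app I \<psi> r"] app_in[OF \<psi>] \<phi>\<psi> by (auto simp: app_def PiE_mem)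
  qed
  with \<psi> show ?case by blast
qed

section \<open>Closed invariant spaces of colourings\<close>

text \<open>The third clause is closedness in the product topology, phrased by agreement on finite
  sets. \<open>Y\<close> is a set of parameters that inflations leave alone: the new coordinate in
  the induction step, a one-point set in the application to trees.\<close>

definition colouring_space ::
  "'i set \<Rightarrow> ('i \<Rightarrow> 'a set) \<Rightarrow> ('i \<Rightarrow> 'a \<Rightarrow> 'a \<Rightarrow> bool) \<Rightarrow> 'y set \<Rightarrow> 'c set \<Rightarrow> (('i \<Rightarrow> 'a) \<times> 'y \<Rightarrow> 'c) set \<Rightarrow> bool" where
  "colouring_space I C le Y A CC \<longleftrightarrow>
     CC \<noteq> {} \<and> CC \<subseteq> PiE I C \<times> Y \<rightarrow> A \<and>
     (\<forall>e \<in> PiE I C \<times> Y \<rightarrow> A. (\<forall>G. finite G \<longrightarrow> G \<subseteq> PiE I C \<times> Y \<longrightarrow> (\<exists>c\<in>CC. \<forall>x\<in>G. c x = e x)) \<longrightarrow> e \<in> CC) \<and>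
     (\<forall>c\<in>CC. \<forall>\<phi>\<in>inflations I C le. (\<lambda>(x, y). c (app I \<phi> x, y)) \<in> CC)"

lemma colouring_space_closed:
  assumes "colouring_space I C le Y A CC" "e \<in> PiE I C \<times> Y \<rightarrow> A"
    and "\<And>G. finite G \<Longrightarrow> G \<subseteq> PiE I C \<times> Y \<Longrightarrow> \<exists>c\<in>CC. \<forall>x\<in>G. c x = e x"
  shows "e \<in> CC"
  using assms(1) unfolding colouring_space_def using assms(2,3) by simp

lemma colouring_space_inflate:
  "colouring_space I C le Y A CC \<Longrightarrow> c \<in> CC \<Longrightarrow> \<phi> \<in> inflations I C le \<Longrightarrow>
    (\<lambda>(x, y). c (app I \<phi> x, y)) \<in> CC"
  unfolding colouring_space_def by simp

lemma colouring_space_funcset: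
  "colouring_space I C le Y A CC \<Longrightarrow> c \<in> CC \<Longrightarrow> c \<in> PiE I C \<times> Y \<rightarrow> A"
  unfolding colouring_space_def by blast

lemma colouring_space_nonempty: "colouring_space I C le Y A CC \<Longrightarrow> CC \<noteq> {}"
  unfolding colouring_space_def by simp

lemma colouring_space_limit:
  fixes c :: "nat \<Rightarrow> ('i \<Rightarrow> 'a) \<times> 'y \<Rightarrow> 'c"
  assumes "finite I" "preorders I C le" "countable Y" "finite A" "colouring_space I C le Y A CC"
    and c: "\<And>n. c n \<in> CC"
  shows "\<exists>e\<in>CC. \<forall>G. finite G \<longrightarrow> G \<subseteq> PiE I C \<times> Y \<longrightarrow> infinite {n. \<forall>x\<in>G. c n x = e x}"
proof -
  have 1: "countable (PiE I C \<times> Y)" using countable_PiE_preorders[OF assms(1,2)] assms(3) by simp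
  have 2: "c n \<in> PiE I C \<times> Y \<rightarrow> A" for n
    by (rule colouring_space_funcset[OF assms(5) c])
  obtain e where e: "e \<in> PiE I C \<times> Y \<rightarrow> A"
    "\<And>G. finite G \<Longrightarrow> G \<subseteq> PiE I C \<times> Y \<Longrightarrow> infinite {n. \<forall>x\<in>G. c n x = e x}"
    using colouring_limit[of "PiE I C \<times> Y" A c, OF 1 \<open>finite A\<close> 2] by blast
  have "\<exists>c\<in>CC. \<forall>x\<in>G. c x = e x" if G: "finite G" "G \<subseteq> PiE I C \<times> Y" for G
  proof -
    obtain n where "\<forall>x\<in>G. c n x = e x" by (rule infinite_natE[OF e(2)[OF G]])
    then show ?thesis using c by (rule bexI)
  qed
  then have "e \<in> CC" by (rule colouring_space_closed[OF assms(5) e(1)])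
  with e(2) show ?thesis by blast
qed

text \<open>The partition property yields the colour \<open>a\<close> only on raised copies of
  finite families above \<open>s\<close>. Raising larger and larger families that exhaust the cone
  gives members of \<open>CC\<close> by invariance, and a cluster point of these has colour
  \<open>a\<close> on the whole cone.\<close>

lemma HL_colouring_space:
  assumes fin: "finite I" and pre: "preorders I C le" and "countable Y" "finite A"
    and CC: "colouring_space I C le Y A CC"
    and s0: "s0 \<in> PiE I C" and y: "y \<in> Y" and HL: "HL I (upper_cone C le s0) le A"
  shows "\<exists>s\<in>PiE I C. \<exists>a\<in>A. \<exists>c\<in>CC. (\<forall>i\<in>I. le i (s0 i) (s i)) \<and>
    (\<forall>x\<in>PiE I (upper_cone C le s). c (x, y) = a)"
proof -
  obtain c where c: "c \<in> CC" "c \<in> PiE I C \<times> Y \<rightarrow> A"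
    using colouring_space_nonempty[OF CC] colouring_space_funcset[OF CC] by blast
  let ?C = "upper_cone C le s0"
  have sub: "PiE I ?C \<subseteq> PiE I C" by (intro PiE_mono) (auto simp: upper_cone_def)
  have c': "(\<lambda>x. c (x, y)) \<in> PiE I ?C \<rightarrow> A" using c(2) y sub by auto
  obtain s a where s: "s \<in> PiE I ?C" "a \<in> A"
    and sa: "\<And>P. finite_family I (upper_cone ?C le s) P \<Longrightarrow>
      \<exists>\<phi>\<in>inflations I ?C le. \<forall>q\<in>PiE I P. c (app I \<phi> q, y) = a"
    using HL[unfolded HL_def, THEN bspec, OF c'] by blast
  have sC: "s i \<in> C i" "le i (s0 i) (s i)" if "i \<in> I" for i
    using s(1) that by (auto simp: upper_cone_def dest!: PiE_mem)
  have s0C: "s0 i \<in> C i" if "i \<in> I" for i using s0 that by auto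
  have up: "x \<in> ?C i" if "i \<in> I" "x \<in> C i" "le i (s i) x" for x i
    using preorders_trans[OF pre that(1) s0C sC(1) that(2) sC(2) that(3)] that by (auto simp: upper_cone_def)
  define P where "P n i = exhaustion C n i \<inter> upper_cone C le s i" for n i
  have "finite_family I (upper_cone ?C le s) (P n)" for n
    using exhaustion_finite_family[OF pre, of n] up
    unfolding finite_family_def P_def by (auto simp: upper_cone_def)
  then have "\<exists>\<phi>\<in>inflations I ?C le. \<forall>q\<in>PiE I (P n). c (app I \<phi> q, y) = a" for n
    using sa by blast
  then obtain \<phi> where \<phi>: "\<And>n. \<phi> n \<in> inflations I ?C le"
    "\<And>n q. q \<in> PiE I (P n) \<Longrightarrow> c (app I (\<phi> n) q, y) = a" by metis
  \<comment> \<open>Each \<open>\<phi> n\<close> is controlled only on the cone above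
    \<open>s0\<close>; continued by the identity it becomes an inflation of all of \<open>C\<close>,
    so that the invariance of \<open>CC\<close> applies.\<close>
  define \<psi> where "\<psi> n i x = (if x \<in> ?C i then \<phi> n i x else x)" for n i x
  have \<psi>: "\<psi> n \<in> inflations I C le" for n
    using \<phi>(1)[of n] preorders_refl[OF pre] unfolding inflations_def \<psi>_def upper_cone_def by auto
  have \<psi>eq: "app I (\<psi> n) q = app I (\<phi> n) q" if "q \<in> PiE I (P n)" for q n
  proof -
    have "q i \<in> ?C i" if "i \<in> I" for i
      using up[OF that] PiE_mem[OF \<open>q \<in> PiE I (P n)\<close> that] by (auto simp: P_def upper_cone_def)
    then show ?thesis by (auto simp: app_def \<psi>_def)
  qed
  have "(\<lambda>(x, y). c (app I (\<psi> n) x, y)) \<in> CC" for n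
    by (rule colouring_space_inflate[OF CC c(1) \<psi>])
  note lim = colouring_space_limit[of I C le Y A CC "\<lambda>n (x, y). c (app I (\<psi> n) x, y)",
      OF fin pre \<open>countable Y\<close> \<open>finite A\<close> CC this]
  obtain e where e: "e \<in> CC" "\<And>G. finite G \<Longrightarrow> G \<subseteq> PiE I C \<times> Y \<Longrightarrow>
      infinite {n. \<forall>x\<in>G. (case x of (x, y) \<Rightarrow> c (app I (\<psi> n) x, y)) = e x}"
    using lim by blast
  have "e (x, y) = a" if x: "x \<in> PiE I (upper_cone C le s)" for x
  proof -
    have xB: "x \<in> PiE I C" using x by (auto simp: upper_cone_def PiE_iff)
    obtain m where m: "\<And>n. n \<ge> m \<Longrightarrow> x \<in> PiE I (exhaustion C n)"
      using exhaustion_covers[OF fin pre, of "{x}"] xB by auto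
    have "infinite {n. c (app I (\<psi> n) x, y) = e (x, y)}"
      using e(2)[of "{(x, y)}"] xB y by simp
    then obtain n where n: "n \<ge> m" "c (app I (\<psi> n) x, y) = e (x, y)"
      by (rule infinite_natE)
    have "x \<in> PiE I (P n)" using m[OF n(1)] x by (auto simp: P_def PiE_iff)
    then show ?thesis using \<phi>(2) \<psi>eq n(2) by metis
  qed
  then have "\<forall>x\<in>PiE I (upper_cone C le s). e (x, y) = a" by blast
  moreover have "\<forall>i\<in>I. le i (s0 i) (s i)" using sC(2) by blast
  moreover have "s \<in> PiE I C" using s(1) sub by blast
  ultimately show ?thesis using s(2) e(1) by blast
qed

text \<open>A Baire type argument: every pair \<open>(s, y)\<close> is a requirement that is met by
  shrinking the colouring space, and compactness gives a common member of the decreasing spaces. A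
  requirement may start at any \<open>s\<close>, so \<open>HL\<close> is assumed on all
  cones.\<close>

lemma colouring_space_locally_constant:
  assumes fin: "finite I" and pre: "preorders I C le" and Y: "countable Y" and A: "finite A"
    and CC: "colouring_space I C le Y A CC"
    and HL: "\<And>s. s \<in> PiE I C \<Longrightarrow> HL I (upper_cone C le s) le A"
  shows "\<exists>c\<in>CC. \<forall>s\<in>PiE I C. \<forall>y\<in>Y. \<exists>t\<in>PiE I C.
    (\<forall>i\<in>I. le i (s i) (t i)) \<and> (\<exists>a. \<forall>x\<in>PiE I (upper_cone C le t). c (x, y) = a)"
proof (cases "Y = {}")
  case True
  then show ?thesis using colouring_space_nonempty[OF CC] by blast
next
  case False
  let ?B = "PiE I C \<times> Y"
  have "PiE I C \<noteq> {}" using preorders_nonempty[OF pre] by (auto simp: PiE_eq_empty_iff)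
  with False have ne: "?B \<noteq> {}" by blast
  have cB: "countable ?B" using countable_PiE_preorders[OF fin pre] Y by blast
  define z where "z = from_nat_into ?B"
  have zB: "z n \<in> ?B" for n unfolding z_def using ne by (rule from_nat_into)
  have "\<exists>D :: nat \<Rightarrow> (('a \<Rightarrow> 'b) \<times> 'c \<Rightarrow> 'd) set. \<forall>n. (colouring_space I C le Y A (D n) \<and> D n \<subseteq> CC) \<and>
      (D (Suc n) \<subseteq> D n \<and> (\<exists>t\<in>PiE I C. (\<forall>i\<in>I. le i (fst (z n) i) (t i)) \<and>
        (\<exists>a. \<forall>c\<in>D (Suc n). \<forall>x\<in>PiE I (upper_cone C le t). c (x, snd (z n)) = a)))"
  proof (rule dependent_nat_choice)
    show "\<exists>D. colouring_space I C le Y A D \<and> D \<subseteq> CC" using CC by blast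
  next
    fix D and n :: nat assume "colouring_space I C le Y A D \<and> D \<subseteq> CC"
    then have D: "colouring_space I C le Y A D" "D \<subseteq> CC" by blast+
    obtain s0 y where z: "z n = (s0, y)" by force
    with zB[of n] have s0: "s0 \<in> PiE I C" and y: "y \<in> Y" by auto
    obtain s a c where s: "s \<in> PiE I C" "\<forall>i\<in>I. le i (s0 i) (s i)" "a \<in> A" "c \<in> D"
      "\<forall>x\<in>PiE I (upper_cone C le s). c (x, y) = a"
      using HL_colouring_space[OF fin pre Y A D(1) s0 y HL[OF s0]] by blast
    \<comment> \<open>Being constant on this cone is a condition on single values, hence closed, and
      an inflation maps the cone into itself, hence the condition is invariant. The next requirement
      can therefore be treated inside this subspace.\<close>
    let ?D = "{c \<in> D. \<forall>x\<in>PiE I (upper_cone C le s). c (x, y) = a}"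
    have coneB: "PiE I (upper_cone C le s) \<subseteq> PiE I C" by (intro PiE_mono) (auto simp: upper_cone_def)
    have "colouring_space I C le Y A ?D"
      unfolding colouring_space_def
    proof (intro conjI ballI impI)
      show "?D \<noteq> {}" using s by blast
      show "?D \<subseteq> ?B \<rightarrow> A" using colouring_space_funcset[OF D(1)] by blast
    next
      fix e assume e: "e \<in> ?B \<rightarrow> A"
        and app: "\<forall>G. finite G \<longrightarrow> G \<subseteq> ?B \<longrightarrow> (\<exists>c\<in>?D. \<forall>x\<in>G. c x = e x)"
      have "e \<in> D"
      proof (rule colouring_space_closed[OF D(1) e])
        fix G assume "finite G" "G \<subseteq> ?B"
        then obtain c where "c \<in> ?D" "\<forall>x\<in>G. c x = e x" using app by meson
        then show "\<exists>c\<in>D. \<forall>x\<in>G. c x = e x" by blast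
      qed
      moreover have "e (x, y) = a" if "x \<in> PiE I (upper_cone C le s)" for x
      proof -
        have "{(x, y)} \<subseteq> ?B" using that coneB y by blast
        then obtain c where "c \<in> ?D" "c (x, y) = e (x, y)" using app[rule_format, of "{(x, y)}"] by auto
        then show ?thesis using that by auto
      qed
      ultimately show "e \<in> ?D" by blast
    next
      fix c \<phi> assume c: "c \<in> ?D" and \<phi>: "\<phi> \<in> inflations I C le"
      have "app I \<phi> x \<in> PiE I (upper_cone C le s)" if x: "x \<in> PiE I (upper_cone C le s)" for x
      proof (rule PiE_I)
        fix i assume i: "i \<in> I"
        have xB: "x \<in> PiE I C" using x coneB by blast
        have "app I \<phi> x i \<in> C i" "le i (x i) (app I \<phi> x i)"
          using app_in[OF \<phi> xB] app_ge[OF \<phi> xB] i by auto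
        then show "app I \<phi> x i \<in> upper_cone C le s i"
          using preorders_trans[OF pre i, of "s i" "x i"] x s(1) i by (auto simp: upper_cone_def PiE_iff)
      qed (simp add: app_def)
      then show "(\<lambda>(x, y). c (app I \<phi> x, y)) \<in> ?D"
        using colouring_space_inflate[OF D(1) _ \<phi>] c by auto
    qed
    then show "\<exists>D'. (colouring_space I C le Y A D' \<and> D' \<subseteq> CC) \<and> D' \<subseteq> D \<and>
       (\<exists>t\<in>PiE I C. (\<forall>i\<in>I. le i (fst (z n) i) (t i)) \<and>
        (\<exists>a. \<forall>c\<in>D'. \<forall>x\<in>PiE I (upper_cone C le t). c (x, snd (z n)) = a))"
      using s(1,2) z D(2) by (intro exI[of _ ?D] conjI) auto
  qed
  then obtain D :: "nat \<Rightarrow> (('a \<Rightarrow> 'b) \<times> 'c \<Rightarrow> 'd) set" where D: "\<And>n. colouring_space I C le Y A (D n)" "\<And>n. D n \<subseteq> CC" "\<And>n. D (Suc n) \<subseteq> D n"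
    and D2: "\<And>n :: nat. \<exists>t\<in>PiE I C. (\<forall>i\<in>I. le i (fst (z n) i) (t i)) \<and>
        (\<exists>a. \<forall>c\<in>D (Suc n). \<forall>x\<in>PiE I (upper_cone C le t). c (x, snd (z n)) = a)"
    by metis
  have dec: "D n \<subseteq> D m" if "m \<le> n" for m n
    using lift_Suc_antimono_le[of D, OF D(3) that] .
  have "\<exists>c. c \<in> D n" for n using colouring_space_nonempty[OF D(1)] by blast
  then obtain c where c: "\<And>n. c n \<in> D n" by metis
  have "\<And>n. c n \<in> CC" using c D(2) by blast
  note lim = colouring_space_limit[of I C le Y A CC c, OF fin pre Y A CC this]
  obtain e where e: "e \<in> CC" "\<And>G. finite G \<Longrightarrow> G \<subseteq> ?B \<Longrightarrow> infinite {n. \<forall>x\<in>G. c n x = e x}"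
    using lim by blast
  \<comment> \<open>On each finite set \<open>e\<close> agrees with infinitely many
    \<open>c n\<close>, and \<open>c n\<close> lies in \<open>D m\<close> as soon as
    \<open>n \<ge> m\<close>.\<close>
  have eD: "e \<in> D m" for m
  proof (rule colouring_space_closed[OF D(1) colouring_space_funcset[OF CC e(1)]])
    fix G assume G: "finite G" "G \<subseteq> ?B"
    obtain n where "n \<ge> m" "\<forall>x\<in>G. c n x = e x"
      using infinite_natE[OF e(2)[OF G]] by blast
    then show "\<exists>c\<in>D m. \<forall>x\<in>G. c x = e x" using c dec by blast
  qed
  show ?thesis
  proof (intro bexI[OF _ e(1)] ballI)
    fix s y assume "s \<in> PiE I C" "y \<in> Y"
    then have z': "z (to_nat_on ?B (s, y)) = (s, y)" unfolding z_def using cB by simp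
    from D2[of "to_nat_on ?B (s, y)", unfolded z' fst_conv snd_conv]
    obtain t a where t: "t \<in> PiE I C" "\<forall>i\<in>I. le i (s i) (t i)"
      "\<forall>c\<in>D (Suc (to_nat_on ?B (s, y))). \<forall>x\<in>PiE I (upper_cone C le t). c (x, y) = a"
      by (elim bexE conjE exE)
    have "\<forall>x\<in>PiE I (upper_cone C le t). e (x, y) = a" using t(3) eD by (rule bspec)
    with t(1,2) show "\<exists>t\<in>PiE I C. (\<forall>i\<in>I. le i (s i) (t i)) \<and>
        (\<exists>a. \<forall>x\<in>PiE I (upper_cone C le t). e (x, y) = a)"
      by (intro bexI[of _ t] conjI exI[of _ a])
  qed
qed

section \<open>Settled tuples and the induction on the number of factors\<close>

definition settled :: "'i set \<Rightarrow> ('i \<Rightarrow> 'a set) \<Rightarrow> ('i \<Rightarrow> 'a \<Rightarrow> 'a \<Rightarrow> bool) \<Rightarrow> (('i \<Rightarrow> 'a) \<Rightarrow> 'c) \<Rightarrow> ('i \<Rightarrow> 'a) \<Rightarrow> bool" where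
  "settled I C le c x \<longleftrightarrow> (\<forall>x'\<in>PiE I (upper_cone C le x). c x' = c x)"

lemma settled_upward:
  assumes pre: "preorders I C le" and x: "x \<in> PiE I C" "settled I C le c x"
    and y: "y \<in> PiE I C" "\<And>i. i \<in> I \<Longrightarrow> le i (x i) (y i)"
  shows "settled I C le c y" "c y = c x"
proof -
  have "PiE I (upper_cone C le y) \<subseteq> PiE I (upper_cone C le x)"
  proof (intro PiE_mono subsetI)
    fix i z assume i: "i \<in> I" and z: "z \<in> upper_cone C le y i"
    have "x i \<in> C i" "y i \<in> C i" using x(1) y(1) i by auto
    then show "z \<in> upper_cone C le x i"
      using preorders_trans[OF pre i, of "x i" "y i" z] y(2)[OF i] z by (auto simp: upper_cone_def)
  qed
  moreover have "y \<in> PiE I (upper_cone C le x)"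
    using y by (auto simp: upper_cone_def PiE_iff)
  ultimately show "settled I C le c y" "c y = c x"
    using x(2) unfolding settled_def by auto
qed

text \<open>The settled tuples are upward closed, and \<open>dense\<close> makes them cofinal, since
  the apex of a cone on which \<open>c\<close> is constant is settled. So a single inflation can
  move finitely many tuples among them.\<close>

lemma settle_finite:
  assumes pre: "preorders I C le" and G: "finite G" "G \<subseteq> PiE I C"
    and dense: "\<And>s. s \<in> PiE I C \<Longrightarrow>
      \<exists>t\<in>PiE I C. (\<forall>i\<in>I. le i (s i) (t i)) \<and> (\<exists>a. \<forall>x\<in>PiE I (upper_cone C le t). c x = a)"
  shows "\<exists>\<phi>\<in>inflations I C le. \<forall>q\<in>G. settled I C le c (app I \<phi> q)"
proof -
  let ?U = "{x \<in> PiE I C. settled I C le c x}"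
  have "\<exists>\<phi>\<in>inflations I C le. \<forall>q\<in>G. app I \<phi> q \<in> ?U"
  proof (rule inflate_into_dense[OF pre G])
    fix x y assume "x \<in> ?U" "y \<in> PiE I C" "\<And>i. i \<in> I \<Longrightarrow> le i (x i) (y i)"
    then show "y \<in> ?U" using settled_upward(1)[OF pre, of x c y] by blast
  next
    fix x assume "x \<in> PiE I C"
    then obtain t a where t: "t \<in> PiE I C" "\<forall>i\<in>I. le i (x i) (t i)"
      "\<forall>x\<in>PiE I (upper_cone C le t). c x = a" using dense by blast
    have "t \<in> PiE I (upper_cone C le t)"
      using t(1) preorders_refl[OF pre] by (auto simp: upper_cone_def PiE_iff)
    with t(3) have "settled I C le c t" unfolding settled_def by auto
    with t show "\<exists>y\<in>PiE I C \<inter> ?U. \<forall>i\<in>I. le i (x i) (y i)" by blast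
  qed
  then show ?thesis by blast
qed

text \<open>If no triple worked, then the countably many pairs \<open>(x, a)\<close> could be refuted one after the
  other along an increasing sequence \<open>y\<close>; a limit colouring of the settled values along \<open>y\<close> would
  then contradict the partition property for \<open>I\<close>.\<close>

lemma HL_step_settled:
  fixes c :: "('i \<Rightarrow> 'a) \<times> 'y \<Rightarrow> 'c"
  assumes fin: "finite I" and pre: "preorders I C le" and A: "finite A" "A \<noteq> {}"
    and HL: "HL I C le A" and Y: "Y \<noteq> {}"
    and refl: "\<And>y. y \<in> Y \<Longrightarrow> R y y"
    and trans: "\<And>x y z. x \<in> Y \<Longrightarrow> y \<in> Y \<Longrightarrow> z \<in> Y \<Longrightarrow> R x y \<Longrightarrow> R y z \<Longrightarrow> R x z"
    and c: "c \<in> PiE I C \<times> Y \<rightarrow> A"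
    and dense: "\<And>s y. s \<in> PiE I C \<Longrightarrow> y \<in> Y \<Longrightarrow>
      \<exists>t\<in>PiE I C. (\<forall>i\<in>I. le i (s i) (t i)) \<and> (\<exists>a. \<forall>x\<in>PiE I (upper_cone C le t). c (x, y) = a)"
  shows "\<exists>x\<in>PiE I C. \<exists>y\<in>Y. \<exists>a\<in>A. \<forall>P. \<forall>r\<in>Y. finite_family I (upper_cone C le x) P \<longrightarrow> R y r \<longrightarrow>
    (\<exists>\<phi>\<in>inflations I C le. \<exists>y'\<in>Y. R r y' \<and>
      (\<forall>q\<in>PiE I P. settled I C le (\<lambda>x. c (x, y')) (app I \<phi> q) \<and> c (app I \<phi> q, y') = a))"
proof (rule ccontr)
  define works where "works P r a \<longleftrightarrow> (\<exists>\<phi>\<in>inflations I C le. \<exists>y'\<in>Y. R r y' \<and>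
      (\<forall>q\<in>PiE I P. settled I C le (\<lambda>x. c (x, y')) (app I \<phi> q) \<and> c (app I \<phi> q, y') = a))" for P r a
  assume "\<not> ?thesis"
  then have dead: "\<exists>P r. r \<in> Y \<and> finite_family I (upper_cone C le x) P \<and> R y r \<and> \<not> works P r a"
    if "x \<in> PiE I C" "y \<in> Y" "a \<in> A" for x y a
    unfolding works_def[symmetric] using that by blast
  let ?B = "PiE I C"
  have "?B \<noteq> {}" using preorders_nonempty[OF pre] by (auto simp: PiE_eq_empty_iff)
  then have ne: "?B \<times> A \<noteq> {}" using A(2) by blast
  have cB: "countable ?B" using countable_PiE_preorders[OF fin pre] .
  have cBA: "countable (?B \<times> A)" using cB countable_finite[OF A(1)] by (rule countable_SIGMA)
  define z where "z = from_nat_into (?B \<times> A)"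
  have z: "fst (z n) \<in> ?B" "snd (z n) \<in> A" for n
    using from_nat_into[OF ne, of n] unfolding z_def by auto
  \<comment> \<open>The element refuting the \<open>n\<close>-th pair becomes
    \<open>y (Suc n)\<close>: it lies above \<open>y n\<close>, and every later term lies above
    it.\<close>
  have "\<exists>y. \<forall>n :: nat. y n \<in> Y \<and> (R (y n) (y (Suc n)) \<and>
    (\<exists>P. finite_family I (upper_cone C le (fst (z n))) P \<and> \<not> works P (y (Suc n)) (snd (z n))))"
  proof (rule dependent_nat_choice)
    show "\<exists>y. y \<in> Y" using Y by blast
  next
    fix y and n :: nat assume "y \<in> Y"
    from dead[OF z(1) this z(2)]
    show "\<exists>r. r \<in> Y \<and> (R y r \<and>
      (\<exists>P. finite_family I (upper_cone C le (fst (z n))) P \<and> \<not> works P r (snd (z n))))"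
      by blast
  qed
  then obtain y where y: "\<forall>n :: nat. y n \<in> Y \<and> (R (y n) (y (Suc n)) \<and>
    (\<exists>P. finite_family I (upper_cone C le (fst (z n))) P \<and> \<not> works P (y (Suc n)) (snd (z n))))" ..
  have yY: "y n \<in> Y" for n using y by blast
  have yR: "R (y m) (y n)" if "m \<le> n" for m n
    using that
  proof (induction rule: dec_induct)
    case base
    then show ?case using refl yY by blast
  next
    case (step n)
    then show ?case using trans[OF yY yY yY] y by blast
  qed
  have "\<exists>\<phi>\<in>inflations I C le. \<forall>q\<in>PiE I (exhaustion C n). settled I C le (\<lambda>x. c (x, y n)) (app I \<phi> q)" for n
    using finite_family_PiE[OF fin exhaustion_finite_family[OF pre]]
      finite_family_mono[OF exhaustion_finite_family[OF pre]] dense[OF _ yY]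
    by (intro settle_finite[OF pre])
  then obtain \<phi> where \<phi>: "\<And>n. \<phi> n \<in> inflations I C le"
    "\<And>n q. q \<in> PiE I (exhaustion C n) \<Longrightarrow> settled I C le (\<lambda>x. c (x, y n)) (app I (\<phi> n) q)"
    by metis
  have "(\<lambda>q. c (app I (\<phi> n) q, y n)) \<in> ?B \<rightarrow> A" for n
    using c yY app_in[OF \<phi>(1)] by blast
  \<comment> \<open>For finitely many tuples at once, \<open>e\<close> agrees with the colours of
    their raised copies at the parameter \<open>y n\<close> for infinitely many \<open>n\<close>;
    for large \<open>n\<close> these copies are settled as well.\<close>
  note lim = colouring_limit[of ?B A "\<lambda>n q. c (app I (\<phi> n) q, y n)", OF cB A(1) this]
  obtain e where e: "e \<in> ?B \<rightarrow> A"
    "\<And>G. finite G \<Longrightarrow> G \<subseteq> ?B \<Longrightarrow> infinite {n. \<forall>q\<in>G. c (app I (\<phi> n) q, y n) = e q}"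
    using lim by blast
  obtain x a where x: "x \<in> ?B" "a \<in> A" and xa: "\<And>P. finite_family I (upper_cone C le x) P \<Longrightarrow>
      \<exists>\<psi>\<in>inflations I C le. \<forall>q\<in>PiE I P. e (app I \<psi> q) = a"
    using HL[unfolded HL_def, THEN bspec, OF e(1)] by blast
  define k where "k = to_nat_on (?B \<times> A) (x, a)"
  have zk: "z k = (x, a)" unfolding z_def k_def using cBA x by simp
  obtain P where P: "finite_family I (upper_cone C le x) P" "\<not> works P (y (Suc k)) a"
    using y[rule_format, of k] zk by auto
  obtain \<psi> where \<psi>: "\<psi> \<in> inflations I C le" "\<And>q. q \<in> PiE I P \<Longrightarrow> e (app I \<psi> q) = a"
    using xa[OF P(1)] by blast
  have PC: "finite_family I C P"
    using P(1) by (auto simp: finite_family_def upper_cone_def)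
  define G where "G = app I \<psi> ` PiE I P"
  have G: "finite G" using finite_family_PiE[OF fin PC] by (simp add: G_def)
  have GB: "G \<subseteq> ?B"
    unfolding G_def using app_in[OF \<psi>(1)] finite_family_mono[OF PC] by (intro image_subsetI) blast
  obtain m where m: "\<And>n. n \<ge> m \<Longrightarrow> G \<subseteq> PiE I (exhaustion C n)"
    using exhaustion_covers[OF fin pre G GB] by blast
  \<comment> \<open>\<open>n \<ge> Suc k\<close> puts \<open>y n\<close> above the element that
    refutes the pair \<open>(x, a)\<close>, and \<open>n \<ge> m\<close> makes the raised copies
    settled. Then \<open>\<psi>\<close> followed by \<open>\<phi> n\<close> is an inflation of the
    kind that was supposed not to exist.\<close>
  obtain n where n: "n \<ge> max m (Suc k)" "\<forall>q\<in>G. c (app I (\<phi> n) q, y n) = e q"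
    using infinite_natE[OF e(2)[OF G GB], of "max m (Suc k)"] by blast
  have "settled I C le (\<lambda>x. c (x, y n)) (app I (\<lambda>i x. \<phi> n i (\<psi> i x)) q) \<and>
      c (app I (\<lambda>i x. \<phi> n i (\<psi> i x)) q, y n) = a" if q: "q \<in> PiE I P" for q
  proof -
    have qG: "app I \<psi> q \<in> G" using q by (simp add: G_def)
    then have "app I \<psi> q \<in> PiE I (exhaustion C n)" using m n(1) by auto
    from \<phi>(2)[OF this] n(2) qG \<psi>(2)[OF q] show ?thesis by (auto simp: app_comp)
  qed
  then have "works P (y (Suc k)) a"
    unfolding works_def using inflations_comp[OF pre \<psi>(1) \<phi>(1)[of n]] yY[of n] yR[of "Suc k" n] n(1)
    by (intro bexI[of _ "\<lambda>i x. \<phi> n i (\<psi> i x)"] bexI[of _ "y n"]) auto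
  with P(2) show False ..
qed

text \<open>The hypothesis \<open>step\<close> covers every finite family above \<open>x\<close>, in
  particular the image of \<open>P\<close> under the inflation found so far. The next inflation
  cannot spoil the elements of \<open>S\<close> treated before, because their colours were left
  settled.\<close>

lemma HL_step_finite:
  fixes c :: "('i \<Rightarrow> 'a) \<times> 'y \<Rightarrow> 'c"
  assumes fin: "finite I" and pre: "preorders I C le" and x: "x \<in> PiE I C"
    and step: "\<forall>P. \<forall>r\<in>Y. finite_family I (upper_cone C le x) P \<longrightarrow> R y r \<longrightarrow>
      (\<exists>\<phi>\<in>inflations I C le. \<exists>y'\<in>Y. R r y' \<and>
        (\<forall>q\<in>PiE I P. settled I C le (\<lambda>x. c (x, y')) (app I \<phi> q) \<and> c (app I \<phi> q, y') = a))"
    and P: "finite_family I (upper_cone C le x) P"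
    and S: "finite S" "S \<subseteq> {r \<in> Y. R y r}"
  shows "\<exists>\<phi>\<in>inflations I C le. \<exists>\<eta>. \<forall>r\<in>S. \<eta> r \<in> Y \<and> R r (\<eta> r) \<and>
    (\<forall>q\<in>PiE I P. settled I C le (\<lambda>x. c (x, \<eta> r)) (app I \<phi> q) \<and> c (app I \<phi> q, \<eta> r) = a)"
  using S
proof (induction rule: finite_induct)
  case empty
  then show ?case using id_inflation[OF pre] by blast
next
  case (insert r S)
  then have "S \<subseteq> {r \<in> Y. R y r}" by simp
  from insert.IH[OF this]
  obtain \<phi> \<eta> where \<phi>: "\<phi> \<in> inflations I C le"
    and \<eta>': "\<forall>r\<in>S. \<eta> r \<in> Y \<and> R r (\<eta> r) \<and>
      (\<forall>q\<in>PiE I P. settled I C le (\<lambda>x. c (x, \<eta> r)) (app I \<phi> q) \<and> c (app I \<phi> q, \<eta> r) = a)"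
    by (elim bexE exE)
  note \<eta> = \<eta>'[THEN bspec]
  have PC: "finite_family I C P"
    using P by (auto simp: finite_family_def upper_cone_def)
  have sub: "PiE I P \<subseteq> PiE I C" by (rule finite_family_mono[OF PC])
  have "finite_family I (upper_cone C le x) (\<lambda>i. \<phi> i ` P i)"
    unfolding finite_family_def
  proof (intro ballI conjI subsetI)
    fix i assume i: "i \<in> I"
    then show "finite (\<phi> i ` P i)" using P by (auto simp: finite_family_def)
    fix z assume "z \<in> \<phi> i ` P i"
    then obtain p where p: "p \<in> P i" "z = \<phi> i p" by blast
    then have "p \<in> C i" "le i (x i) p" "x i \<in> C i"
      using P i x by (auto simp: finite_family_def upper_cone_def)
    then show "z \<in> upper_cone C le x i"
      using \<phi> preorders_trans[OF pre i, of "x i" p z] p(2) i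
      by (auto simp: upper_cone_def inflations_def)
  qed
  moreover have "r \<in> Y" "R y r" using insert.prems by auto
  ultimately obtain \<psi> y' where \<psi>: "\<psi> \<in> inflations I C le" "y' \<in> Y" "R r y'"
    and \<psi>q: "\<forall>q\<in>PiE I (\<lambda>i. \<phi> i ` P i). settled I C le (\<lambda>x. c (x, y')) (app I \<psi> q) \<and> c (app I \<psi> q, y') = a"
    using step[THEN spec, THEN bspec, THEN mp, THEN mp] by blast
  let ?\<phi> = "\<lambda>i x. \<psi> i (\<phi> i x)"
  let ?\<eta> = "\<eta>(r := y')"
  have "?\<eta> u \<in> Y \<and> R u (?\<eta> u) \<and> (\<forall>q\<in>PiE I P. settled I C le (\<lambda>x. c (x, ?\<eta> u)) (app I ?\<phi> q) \<and>
      c (app I ?\<phi> q, ?\<eta> u) = a)" if u: "u \<in> insert r S" for u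
  proof (cases "u = r")
    case True
    have "app I \<phi> q \<in> PiE I (\<lambda>i. \<phi> i ` P i)" if "q \<in> PiE I P" for q
      using that by (auto simp: app_def)
    then show ?thesis using \<psi> \<psi>q True by (auto simp: app_comp)
  next
    case False
    then have uS: "u \<in> S" using u by blast
    have "settled I C le (\<lambda>x. c (x, \<eta> u)) (app I \<psi> (app I \<phi> q)) \<and> c (app I \<psi> (app I \<phi> q), \<eta> u) = a"
      if q: "q \<in> PiE I P" for q
    proof -
      have *: "app I \<phi> q \<in> PiE I C" using app_in[OF \<phi>] q sub by blast
      show ?thesis
        using settled_upward[OF pre *, of "\<lambda>x. c (x, \<eta> u)" "app I \<psi> (app I \<phi> q)"]
          app_in[OF \<psi>(1) *] app_ge[OF \<psi>(1) *] \<eta>[OF uS] q by auto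
    qed
    then show ?thesis using \<eta>[OF uS] False by (auto simp: app_comp)
  qed
  then show ?case using inflations_comp[OF pre \<phi> \<psi>(1)] by blast
qed

text \<open>The new coordinate \<open>j\<close> serves as the parameter set, and compactness
  arguments raise only the coordinates in \<open>I\<close>. They replace \<open>c0\<close> by a
  locally constant \<open>c\<close>, which on every finite set is a raised copy of
  \<open>c0\<close>; a finite configuration found for \<open>c\<close> is therefore carried back to
  \<open>c0\<close> by one more inflation. The hypothesis ranges over all \<open>C\<close> because
  it is used on cones.\<close>

lemma HL_insert:
  fixes C :: "'i \<Rightarrow> 'a set" and A :: "'c set"
  assumes fin: "finite I" and j: "j \<notin> I" and pre: "preorders (insert j I) C le" and A: "finite A"
    and HL: "\<And>C :: 'i \<Rightarrow> 'a set. preorders I C le \<Longrightarrow> HL I C le A"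
  shows "HL (insert j I) C le A"
  unfolding HL_def
proof
  fix c0 assume c0: "c0 \<in> PiE (insert j I) C \<rightarrow> A"
  let ?B = "PiE I C" and ?Y = "C j"
  have pI: "preorders I C le" using pre unfolding preorders_def ball_simps by (rule conjunct2)
  have Y: "?Y \<noteq> {}" "countable ?Y" using preorders_nonempty[OF pre] preorders_countable[OF pre] by auto
  have upd: "x(j := y) \<in> PiE (insert j I) C" if "x \<in> ?B" "y \<in> ?Y" for x y
    using that by (rule PiE_fun_upd[rotated])
  have ne: "?B \<noteq> {}" using preorders_nonempty[OF pI] by (auto simp: PiE_eq_empty_iff)
  have Ane: "A \<noteq> {}" using c0 upd ne Y(1) by blast
  \<comment> \<open>The orbit closure of \<open>c0\<close> under raising the coordinates in
    \<open>I\<close>.\<close>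
  define CC where "CC = {c \<in> ?B \<times> ?Y \<rightarrow> A. \<forall>G. finite G \<longrightarrow> G \<subseteq> ?B \<times> ?Y \<longrightarrow>
    (\<exists>\<phi>\<in>inflations I C le. \<forall>(x, y)\<in>G. c (x, y) = c0 ((app I \<phi> x)(j := y)))}"
  have approx: "\<exists>\<phi>\<in>inflations I C le. \<forall>(x, y)\<in>G. c (x, y) = c0 ((app I \<phi> x)(j := y))"
    if "c \<in> CC" "finite G" "G \<subseteq> ?B \<times> ?Y" for c G
    using that unfolding CC_def by simp
  have CC: "colouring_space I C le ?Y A CC"
    unfolding colouring_space_def
  proof (intro conjI ballI impI)
    have "(\<lambda>(x, y). c0 (x(j := y))) \<in> CC"
      unfolding CC_def
    proof (intro CollectI conjI allI impI)
      show "(\<lambda>(x, y). c0 (x(j := y))) \<in> ?B \<times> ?Y \<rightarrow> A" using funcset_mem[OF c0 upd] by auto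
    next
      fix G assume "G \<subseteq> ?B \<times> ?Y"
      then show "\<exists>\<phi>\<in>inflations I C le. \<forall>(x, y)\<in>G. (\<lambda>(x, y). c0 (x(j := y))) (x, y) = c0 ((app I \<phi> x)(j := y))"
        using id_inflation[OF pI] by (intro bexI[of _ "\<lambda>i x. x"]) (auto simp: app_id)
    qed
    then show "CC \<noteq> {}" by blast
    show "CC \<subseteq> ?B \<times> ?Y \<rightarrow> A" by (auto simp: CC_def)
  next
    fix e assume e: "e \<in> ?B \<times> ?Y \<rightarrow> A"
      and app: "\<forall>G. finite G \<longrightarrow> G \<subseteq> ?B \<times> ?Y \<longrightarrow> (\<exists>c\<in>CC. \<forall>x\<in>G. c x = e x)"
    show "e \<in> CC"
      unfolding CC_def
    proof (intro CollectI conjI allI impI e)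
      fix G assume G: "finite G" "G \<subseteq> ?B \<times> ?Y"
      then obtain c where c: "c \<in> CC" "\<forall>x\<in>G. c x = e x" using app by meson
      then obtain \<phi> where "\<phi>\<in>inflations I C le" "\<forall>(x, y)\<in>G. c (x, y) = c0 ((app I \<phi> x)(j := y))"
        using approx[OF c(1) G] by blast
      then show "\<exists>\<phi>\<in>inflations I C le. \<forall>(x, y)\<in>G. e (x, y) = c0 ((app I \<phi> x)(j := y))"
        using c(2) by (intro bexI[of _ \<phi>]) auto
    qed
  next
    fix c \<phi> assume c: "c \<in> CC" and \<phi>: "\<phi> \<in> inflations I C le"
    show "(\<lambda>(x, y). c (app I \<phi> x, y)) \<in> CC"
      unfolding CC_def
    proof (intro CollectI conjI allI impI)
      show "(\<lambda>(x, y). c (app I \<phi> x, y)) \<in> ?B \<times> ?Y \<rightarrow> A"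
      proof (rule funcsetI, clarify)
        fix x y assume "x \<in> ?B" "y \<in> ?Y"
        then have "(app I \<phi> x, y) \<in> ?B \<times> ?Y" using app_in[OF \<phi>] by blast
        moreover have "c \<in> ?B \<times> ?Y \<rightarrow> A" using c unfolding CC_def by simp
        ultimately show "c (app I \<phi> x, y) \<in> A" by (rule funcset_mem[rotated])
      qed
    next
      fix G assume G: "finite G" "G \<subseteq> ?B \<times> ?Y"
      let ?G = "(\<lambda>(x, y). (app I \<phi> x, y)) ` G"
      have *: "finite ?G" using G(1) by blast
      have "?G \<subseteq> ?B \<times> ?Y"
      proof (rule image_subsetI)
        fix z assume z: "z \<in> G"
        obtain x y where xy: "z = (x, y)" by (cases z)
        have "x \<in> ?B" "y \<in> ?Y" using z G(2) xy by blast+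
        then show "(case z of (x, y) \<Rightarrow> (app I \<phi> x, y)) \<in> ?B \<times> ?Y" using app_in[OF \<phi>] xy by simp
      qed
      from approx[OF c * this]
      obtain \<psi> where \<psi>: "\<psi>\<in>inflations I C le" "\<forall>(x, y)\<in>?G. c (x, y) = c0 ((app I \<psi> x)(j := y))"
        by blast
      then show "\<exists>\<theta>\<in>inflations I C le. \<forall>(x, y)\<in>G. (case (x, y) of (x, y) \<Rightarrow> c (app I \<phi> x, y)) = c0 ((app I \<theta> x)(j := y))"
        using inflations_comp[OF pI \<phi> \<psi>(1)] by (intro bexI[of _ "\<lambda>i x. \<psi> i (\<phi> i x)"]) (auto simp: app_comp)
    qed
  qed
  note lc = colouring_space_locally_constant[OF fin pI Y(2) A CC HL[OF preorders_upper_cone[OF pI]]]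
  from lc obtain c where c: "c \<in> CC" and dense': "\<forall>s\<in>?B. \<forall>y\<in>?Y.
      \<exists>t\<in>?B. (\<forall>i\<in>I. le i (s i) (t i)) \<and> (\<exists>a. \<forall>x\<in>PiE I (upper_cone C le t). c (x, y) = a)" ..
  note dense = dense'[THEN bspec, THEN bspec]
  have cA: "c \<in> ?B \<times> ?Y \<rightarrow> A" using c by (simp add: CC_def)
  have refl: "le j y y" if "y \<in> ?Y" for y using preorders_refl[OF pre] that by blast
  have trans: "le j u w" if "u \<in> ?Y" "v \<in> ?Y" "w \<in> ?Y" "le j u v" "le j v w" for u v w
    using preorders_trans[OF pre] that by blast
  have "\<exists>x\<in>?B. \<exists>y\<in>?Y. \<exists>a\<in>A. \<forall>P. \<forall>r\<in>?Y. finite_family I (upper_cone C le x) P \<longrightarrow> le j y r \<longrightarrow>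
      (\<exists>\<phi>\<in>inflations I C le. \<exists>y'\<in>?Y. le j r y' \<and>
        (\<forall>q\<in>PiE I P. settled I C le (\<lambda>x. c (x, y')) (app I \<phi> q) \<and> c (app I \<phi> q, y') = a))"
    by (rule HL_step_settled[OF fin pI A Ane HL[OF pI] Y(1) _ _ cA]) (rule refl trans dense; assumption)+
  then obtain x y a where xya: "x \<in> ?B" "y \<in> ?Y" "a \<in> A" and step: "\<forall>P. \<forall>r\<in>?Y.
      finite_family I (upper_cone C le x) P \<longrightarrow> le j y r \<longrightarrow>
      (\<exists>\<phi>\<in>inflations I C le. \<exists>y'\<in>?Y. le j r y' \<and>
        (\<forall>q\<in>PiE I P. settled I C le (\<lambda>x. c (x, y')) (app I \<phi> q) \<and> c (app I \<phi> q, y') = a))"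
    by (elim bexE)
  have "\<exists>\<phi>\<in>inflations (insert j I) C le. \<forall>q\<in>PiE (insert j I) P. c0 (app (insert j I) \<phi> q) = a"
    if P: "finite_family (insert j I) (upper_cone C le (x(j := y))) P" for P
  proof -
    have PI: "finite_family I (upper_cone C le x) P"
      using P j by (auto simp: finite_family_def upper_cone_def split: if_splits)
    have Pj: "finite (P j)" "P j \<subseteq> {r \<in> ?Y. le j y r}"
      using P by (auto simp: finite_family_def upper_cone_def)
    obtain \<phi> \<eta> where \<phi>: "\<phi> \<in> inflations I C le" and \<eta>: "\<forall>r\<in>P j. \<eta> r \<in> ?Y \<and> le j r (\<eta> r) \<and>
      (\<forall>q\<in>PiE I P. settled I C le (\<lambda>x. c (x, \<eta> r)) (app I \<phi> q) \<and> c (app I \<phi> q, \<eta> r) = a)"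
      using HL_step_finite[OF fin pI xya(1) step PI Pj] by (elim bexE exE)
    have PC: "finite_family I C P" using PI by (auto simp: finite_family_def upper_cone_def)
    let ?G = "(app I \<phi> ` PiE I P) \<times> (\<eta> ` P j)"
    have *: "finite ?G" using finite_family_PiE[OF fin PC] Pj(1) by blast
    have "app I \<phi> ` PiE I P \<subseteq> ?B"
      by (intro image_subsetI app_in[OF \<phi>]) (erule subsetD[OF finite_family_mono[OF PC]])
    moreover have "\<eta> ` P j \<subseteq> ?Y" using \<eta> by blast
    ultimately have "?G \<subseteq> ?B \<times> ?Y" by (rule Sigma_mono)
    from approx[OF c * this] obtain \<psi> where \<psi>: "\<psi> \<in> inflations I C le"
      "\<forall>(x, y)\<in>?G. c (x, y) = c0 ((app I \<psi> x)(j := y))"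
      by blast
    \<comment> \<open>\<open>\<phi>\<close> and \<open>\<eta>\<close> produce the colour
      \<open>a\<close> for \<open>c\<close>, and \<open>\<psi>\<close> makes \<open>c0\<close> copy
      \<open>c\<close> on the tuples concerned. Since \<open>\<psi>\<close> does not touch
      coordinate \<open>j\<close>, only \<open>\<eta>\<close> acts there; outside \<open>P j\<close>
      any inflating value would do.\<close>
    define \<theta> where "\<theta> i p = (if i = j then if p \<in> P j then \<eta> p else p else \<psi> i (\<phi> i p))" for i p
    have "\<theta> \<in> inflations (insert j I) C le"
      using inflations_comp[OF pI \<phi> \<psi>(1)] \<eta> refl j unfolding inflations_def \<theta>_def by auto
    moreover have "c0 (app (insert j I) \<theta> q) = a" if q: "q \<in> PiE (insert j I) P" for q
    proof -
      let ?q = "restrict q I"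
      have qI: "?q \<in> PiE I P" and qj: "q j \<in> P j" using q by auto
      have "app (insert j I) \<theta> q = (app I \<psi> (app I \<phi> ?q))(j := \<eta> (q j))"
        using qj j by (auto simp: app_def \<theta>_def fun_eq_iff)
      moreover have "(app I \<phi> ?q, \<eta> (q j)) \<in> ?G" using qI qj by blast
      ultimately show ?thesis using bspec[OF \<psi>(2)] \<eta>[THEN bspec, OF qj] qI by fastforce
    qed
    ultimately show ?thesis by blast
  qed
  moreover have "x(j := y) \<in> PiE (insert j I) C" by (rule upd[OF xya(1,2)])
  ultimately show "\<exists>s\<in>PiE (insert j I) C. \<exists>a\<in>A. \<forall>P. finite_family (insert j I) (upper_cone C le s) P \<longrightarrow>
     (\<exists>\<phi>\<in>inflations (insert j I) C le. \<forall>q\<in>PiE (insert j I) P. c0 (app (insert j I) \<phi> q) = a)"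
    using xya(3) by blast
qed

theorem Halpern_Laeuchli_preorders:
  assumes "finite I" "preorders I C le" "finite A"
  shows "HL I C le A"
  using assms(1,2)
proof (induction I arbitrary: C rule: finite_induct)
  case empty
  have "(\<lambda>i x. x) \<in> inflations {} C le" by (simp add: inflations_def)
  then show ?case
    unfolding HL_def by (auto simp: app_def)
next
  case (insert j I)
  show ?case
  proof (rule HL_insert[OF insert(1,2) insert.prems assms(3)])
    fix C' :: "'a \<Rightarrow> 'b set" assume "preorders I C' le"
    then show "HL I C' le A" by (rule insert.IH)
  qed
qed

section \<open>Trees of height omega and their branches\<close>

locale omega_tree =
  fixes r :: "'a rel"
  assumes tree: "rooted_omega_tree r"
    and succ: "\<And>x. x \<in> Field r \<Longrightarrow> immediate_successors r x \<noteq> {} \<and> countable (immediate_successors r x)"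
begin

definition ht :: "'a \<Rightarrow> nat" where "ht x = card (underS r x)"

definition anc :: "'a \<Rightarrow> nat \<Rightarrow> 'a" where "anc x n = (THE z. (z, x) \<in> r \<and> ht z = n)"

lemma rel_refl: "x \<in> Field r \<Longrightarrow> (x, x) \<in> r"
  using tree unfolding rooted_omega_tree_def partial_order_on_def preorder_on_def by (auto dest: refl_onD)

lemma rel_trans: "(x, y) \<in> r \<Longrightarrow> (y, z) \<in> r \<Longrightarrow> (x, z) \<in> r"
  using tree unfolding rooted_omega_tree_def partial_order_on_def preorder_on_def by (blast dest: transD)

lemma rel_antisym: "(x, y) \<in> r \<Longrightarrow> (y, x) \<in> r \<Longrightarrow> x = y"
  using tree unfolding rooted_omega_tree_def partial_order_on_def by (blast dest: antisymD)

lemma finite_underS: "x \<in> Field r \<Longrightarrow> finite (underS r x)"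
  using tree unfolding rooted_omega_tree_def by blast

lemma ht_less:
  assumes "(x, y) \<in> r" "x \<noteq> y"
  shows "ht x < ht y"
proof -
  have "underS r x \<subset> underS r y"
    using assms rel_trans rel_antisym unfolding underS_def by blast
  moreover have "finite (underS r y)" using finite_underS assms(1) by (auto simp: Field_def)
  ultimately show ?thesis unfolding ht_def by (rule psubset_card_mono[rotated])
qed

lemma ht_mono: "(x, y) \<in> r \<Longrightarrow> ht x \<le> ht y"
  using ht_less by fastforce

lemma below_comparable:
  assumes "(x, z) \<in> r" "(y, z) \<in> r"
  shows "(x, y) \<in> r \<or> (y, x) \<in> r"
proof -
  have z: "z \<in> Field r" "x \<in> Field r" using assms by (auto simp: Field_def)
  then have "total_on (underS r z) r" using tree unfolding rooted_omega_tree_def by blast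
  then have "x \<in> underS r z \<Longrightarrow> y \<in> underS r z \<Longrightarrow> x \<noteq> y \<Longrightarrow> ?thesis"
    unfolding total_on_def by blast
  then show ?thesis
    using assms rel_refl[OF z(2)] by (cases "x = z"; cases "y = z"; cases "x = y") (auto simp: underS_def)
qed

lemma below_ht_le: "(x, z) \<in> r \<Longrightarrow> (y, z) \<in> r \<Longrightarrow> ht x \<le> ht y \<Longrightarrow> (x, y) \<in> r"
  using below_comparable ht_less by (metis linorder_not_less)

text \<open>By counting: the nodes up to \<open>x\<close> form a chain of \<open>ht x + 1\<close>
  elements on which \<open>ht\<close> is injective with values at most \<open>ht x\<close>, so every
  such value is attained.\<close>

lemma anc_ex:
  assumes x: "x \<in> Field r" and n: "n \<le> ht x"
  shows "\<exists>z. (z, x) \<in> r \<and> ht z = n"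
proof -
  let ?D = "{z. (z, x) \<in> r}"
  have D: "?D = insert x (underS r x)" using rel_refl[OF x] unfolding underS_def by blast
  have "finite ?D" "card ?D = Suc (ht x)"
    using finite_underS[OF x] by (auto simp: D ht_def underS_def)
  moreover have "inj_on ht ?D"
    by (rule inj_onI) (metis below_ht_le rel_antisym order_refl mem_Collect_eq)
  ultimately have "card (ht ` ?D) = card {..ht x}" by (simp add: card_image)
  moreover have "ht ` ?D \<subseteq> {..ht x}" using ht_mono by auto
  ultimately have "ht ` ?D = {..ht x}" by (intro card_subset_eq) auto
  then have "n \<in> ht ` ?D" using n by blast
  then show ?thesis by blast
qed

lemma anc_eqI:
  assumes "(z, x) \<in> r" "ht z = n"
  shows "anc x n = z"
  unfolding anc_def
proof (rule the_equality)
  show "(z, x) \<in> r \<and> ht z = n" using assms by blast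
next
  fix z' assume z': "(z', x) \<in> r \<and> ht z' = n"
  have "(z', z) \<in> r" "(z, z') \<in> r"
    using below_ht_le[of z' x z] below_ht_le[of z x z'] z' assms by auto
  then show "z' = z" by (rule rel_antisym)
qed

lemma anc:
  assumes "x \<in> Field r" "n \<le> ht x"
  shows "(anc x n, x) \<in> r" "ht (anc x n) = n"
  using anc_ex[OF assms] anc_eqI by metis+

lemma tree_level_ht: "tree_level r n = {x \<in> Field r. ht x = n}"
  unfolding tree_level_def ht_def ..

lemma anc_level: "x \<in> Field r \<Longrightarrow> n \<le> ht x \<Longrightarrow> anc x n \<in> tree_level r n"
  using anc FieldI1[OF anc(1)] by (simp add: tree_level_ht)

lemma successor: "x \<in> Field r \<Longrightarrow> \<exists>y. (x, y) \<in> r \<and> ht x < ht y"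
proof -
  assume "x \<in> Field r"
  then obtain y where "y \<in> immediate_successors r x" using succ by blast
  then have "(x, y) \<in> r" "x \<noteq> y" unfolding immediate_successors_def underS_def by auto
  then show ?thesis using ht_less by blast
qed

lemma high_above: "x \<in> Field r \<Longrightarrow> \<exists>y. (x, y) \<in> r \<and> n \<le> ht y"
proof (induction n)
  case 0
  then show ?case using rel_refl by blast
next
  case (Suc n)
  then obtain y where y: "(x, y) \<in> r" "n \<le> ht y" by blast
  then obtain z where "(y, z) \<in> r" "ht y < ht z" using successor[of y] by (auto simp: Field_def)
  then show ?case using y rel_trans by (metis Suc_leI order_le_less_trans)
qed

lemma countable_level: "countable {x \<in> Field r. ht x = n}"
proof (induction n)
  case 0
  obtain root where root: "\<And>x. x \<in> Field r \<Longrightarrow> (root, x) \<in> r"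
    using tree unfolding rooted_omega_tree_def by blast
  have "x = root" if "x \<in> Field r" "ht x = 0" for x
    using root[OF that(1)] ht_less[of root x] that(2) by auto
  then have "{x \<in> Field r. ht x = 0} \<subseteq> {root}" by blast
  then show ?case by (rule countable_subset) simp
next
  case (Suc n)
  have "{x \<in> Field r. ht x = Suc n} \<subseteq> (\<Union>x\<in>{x \<in> Field r. ht x = n}. immediate_successors r x)"
  proof
    fix y assume "y \<in> {x \<in> Field r. ht x = Suc n}"
    then have y: "y \<in> Field r" "ht y = Suc n" by auto
    let ?z = "anc y n"
    have z: "(?z, y) \<in> r" "ht ?z = n" using anc[of y n] y by auto
    have "w \<notin> underS r y" if "?z \<in> underS r w" for w
      using that ht_less[of ?z w] ht_less[of w y] z(2) y(2) unfolding underS_def by auto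
    then have "y \<in> immediate_successors r ?z"
      using z y unfolding immediate_successors_def underS_def by auto
    then show "y \<in> (\<Union>x\<in>{x \<in> Field r. ht x = n}. immediate_successors r x)"
      using z by (auto simp: Field_def)
  qed
  moreover have "countable (\<Union>x\<in>{x \<in> Field r. ht x = n}. immediate_successors r x)"
    using Suc.IH succ by (intro countable_UN) auto
  ultimately show ?case by (rule countable_subset)
qed

lemma countable_Field: "countable (Field r)"
proof -
  have "countable (\<Union>n. {x \<in> Field r. ht x = n})" using countable_level by (intro countable_UN) auto
  then show ?thesis by (rule countable_subset[rotated]) blast
qed

lemma Field_nonempty: "Field r \<noteq> {}"
  using tree unfolding rooted_omega_tree_def by blast

lemma sequence_mono:
  assumes t: "\<And>n. (t n, t (Suc n)) \<in> r" and "m \<le> n"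
  shows "(t m, t n) \<in> r"
  using \<open>m \<le> n\<close>
proof (induction rule: dec_induct)
  case base
  then show ?case using t[of m] rel_refl by (auto simp: Field_def)
next
  case (step n)
  then show ?case using t rel_trans by blast
qed

text \<open>The downward closure is maximal because the heights are unbounded: a node comparable
  with every \<open>t m\<close> must lie below one that is higher than itself.\<close>

lemma sequence_branch:
  assumes t: "\<And>n. (t n, t (Suc n)) \<in> r" and unb: "\<And>n. \<exists>m. n \<le> ht (t m)"
  shows "{x. \<exists>n. (x, t n) \<in> r} \<in> branches r"
proof -
  let ?b = "{x. \<exists>n. (x, t n) \<in> r}"
  have tF: "t n \<in> Field r" for n using t[of n] by (auto simp: Field_def)
  have tb: "t n \<in> ?b" for n using rel_refl[OF tF] by blast
  have up: "(x, t n) \<in> r" if "(x, t m) \<in> r" "m \<le> n" for x m n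
    using sequence_mono[of t, OF t that(2)] that(1) rel_trans by blast
  have "?b \<in> Chains r"
    unfolding Chains_def
  proof (intro CollectI ballI)
    fix x y assume "x \<in> ?b" "y \<in> ?b"
    then obtain m n where mn: "(x, t m) \<in> r" "(y, t n) \<in> r" by blast
    have "(x, t (max m n)) \<in> r" "(y, t (max m n)) \<in> r"
      using up[OF mn(1), of "max m n"] up[OF mn(2), of "max m n"] by auto
    then show "(x, y) \<in> r \<or> (y, x) \<in> r" by (rule below_comparable)
  qed
  moreover have "infinite ?b"
  proof
    assume "finite ?b"
    then obtain k where "\<forall>x\<in>ht ` ?b. x \<le> k" using finite_nat_set_iff_bounded_le by blast
    then have k: "\<And>x. x \<in> ?b \<Longrightarrow> ht x \<le> k" by blast
    obtain m where m: "Suc k \<le> ht (t m)" using unb by blast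
    show False using k[OF tb, of m] m by linarith
  qed
  moreover have "c = ?b" if c: "c \<in> Chains r" "?b \<subseteq> c" for c
  proof (rule equalityI[OF subsetI that(2)])
    fix x assume x: "x \<in> c"
    obtain m where m: "Suc (ht x) \<le> ht (t m)" using unb by blast
    have "t m \<in> c" using tb c(2) by blast
    then have "(x, t m) \<in> r \<or> (t m, x) \<in> r" using x c(1) unfolding Chains_def by blast
    moreover have "(t m, x) \<notin> r" using ht_mono[of "t m" x] m by auto
    ultimately show "x \<in> ?b" by blast
  qed
  ultimately show ?thesis unfolding branches_def by blast
qed

lemma branch_Field: "b \<in> branches r \<Longrightarrow> x \<in> b \<Longrightarrow> x \<in> Field r"
  unfolding branches_def Chains_def Field_def by blast

lemma branch_comparable: "b \<in> branches r \<Longrightarrow> x \<in> b \<Longrightarrow> y \<in> b \<Longrightarrow> (x, y) \<in> r \<or> (y, x) \<in> r"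
  unfolding branches_def Chains_def by blast

lemma branch_ht_le: "b \<in> branches r \<Longrightarrow> x \<in> b \<Longrightarrow> y \<in> b \<Longrightarrow> ht x \<le> ht y \<Longrightarrow> (x, y) \<in> r"
  using branch_comparable ht_less by (metis linorder_not_less)

text \<open>By maximality, since the downward closure of a branch is a chain that contains
  it.\<close>

lemma branch_down:
  assumes b: "b \<in> branches r" and "x \<in> b" "(y, x) \<in> r"
  shows "y \<in> b"
proof -
  let ?c = "{y. \<exists>x\<in>b. (y, x) \<in> r}"
  have "?c \<in> Chains r"
    unfolding Chains_def
  proof (intro CollectI ballI)
    fix u v assume "u \<in> ?c" "v \<in> ?c"
    then obtain x y where xy: "x \<in> b" "y \<in> b" "(u, x) \<in> r" "(v, y) \<in> r" by blast
    then consider "(x, y) \<in> r" | "(y, x) \<in> r" using branch_comparable[OF b] by blast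
    then show "(u, v) \<in> r \<or> (v, u) \<in> r"
    proof cases
      case 1
      then show ?thesis using below_comparable[of u y v] rel_trans[of u x y] xy by blast
    next
      case 2
      then show ?thesis using below_comparable[of u x v] rel_trans[of v y x] xy by blast
    qed
  qed
  moreover have "b \<subseteq> ?c"
  proof
    fix y assume "y \<in> b"
    then show "y \<in> ?c" using rel_refl[OF branch_Field[OF b]] by blast
  qed
  ultimately have "?c = b" using b unfolding branches_def by simp
  then show ?thesis using assms by blast
qed

text \<open>This allows the lower levels of a branch to be read off from any single high node on it,
  before the rest of the branch has been constructed.\<close>

lemma branch_node_eq:
  assumes b: "b \<in> branches r" and x: "x \<in> b" and n: "n \<le> ht x"
  shows "branch_node r b n = anc x n"
  unfolding branch_node_def
proof (rule the_equality)
  have xF: "x \<in> Field r" using branch_Field[OF b x] .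
  show "anc x n \<in> b \<and> anc x n \<in> tree_level r n"
    using branch_down[OF b x] anc(1)[OF xF n] anc_level[OF xF n] by blast
next
  fix z assume z: "z \<in> b \<and> z \<in> tree_level r n"
  then have "(z, x) \<in> r" using branch_ht_le[OF b _ x] n by (auto simp: tree_level_ht)
  then show "z = anc x n" using anc_eqI z by (auto simp: tree_level_ht)
qed

lemma branch_through:
  assumes x: "x \<in> Field r"
  shows "\<exists>b\<in>branches r. x \<in> b"
proof -
  have "\<exists>t. \<forall>n. ((x, t n) \<in> r \<and> n \<le> ht (t n)) \<and> (t n, t (Suc n)) \<in> r"
  proof (rule dependent_nat_choice)
    show "\<exists>y. (x, y) \<in> r \<and> 0 \<le> ht y" using rel_refl[OF x] by blast
  next
    fix y n assume y: "(x, y) \<in> r \<and> n \<le> ht y"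
    then have "y \<in> Field r" by (auto simp: Field_def)
    then obtain z where "(y, z) \<in> r" "Suc n \<le> ht z" using high_above by blast
    then show "\<exists>z. ((x, z) \<in> r \<and> Suc n \<le> ht z) \<and> (y, z) \<in> r" using y rel_trans by blast
  qed
  then obtain t where t: "\<And>n. (x, t n) \<in> r" "\<And>n. n \<le> ht (t n)" "\<And>n. (t n, t (Suc n)) \<in> r" by blast
  have "{y. \<exists>n. (y, t n) \<in> r} \<in> branches r"
    by (rule sequence_branch[of t]) (rule t(3), rule exI, rule t(2))
  moreover have "x \<in> {y. \<exists>n. (y, t n) \<in> r}" using t(1)[of 0] by (intro CollectI exI)
  ultimately show ?thesis by (rule bexI[rotated])
qed

section \<open>The topology of the branch space\<close>

lemma topspace_branch_topology: "topspace (branch_topology r) = branches r"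
proof -
  have "b \<in> \<Union> {{b \<in> branches r. x \<in> b} |x. x \<in> Field r}" if b: "b \<in> branches r" for b
  proof -
    have "b \<noteq> {}" using b unfolding branches_def by auto
    then obtain x where "x \<in> b" by blast
    then show ?thesis using branch_Field[OF b] b by blast
  qed
  then show ?thesis unfolding branch_topology_def topology_generated_by_topspace by blast
qed

lemma openin_node: "x \<in> Field r \<Longrightarrow> openin (branch_topology r) {b \<in> branches r. x \<in> b}"
  unfolding branch_topology_def by (rule topology_generated_by_Basis) blast

text \<open>Two nodes of \<open>b\<close> are comparable, and the neighbourhood of the upper one is
  contained in that of the lower one; so finite intersections of generating sets need no separate
  treatment.\<close>

lemma open_contains_node:
  assumes "openin (branch_topology r) U" "b \<in> U"
  shows "\<exists>x\<in>b. {b \<in> branches r. x \<in> b} \<subseteq> U"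
proof -
  have "generate_topology_on {{b \<in> branches r. x \<in> b} |x. x \<in> Field r} U"
    using assms(1) unfolding branch_topology_def openin_topology_generated_by_iff .
  moreover have "b \<in> branches r"
    using assms openin_subset topspace_branch_topology by blast
  ultimately show ?thesis using assms(2)
  proof (induction U rule: generate_topology_on.induct)
    case (Int U V)
    then obtain x y where xy: "x \<in> b" "{b \<in> branches r. x \<in> b} \<subseteq> U" "y \<in> b" "{b \<in> branches r. y \<in> b} \<subseteq> V"
      by blast
    from Int.prems(1) xy(1,3) consider "(x, y) \<in> r" | "(y, x) \<in> r" using branch_comparable by blast
    then show ?case
    proof cases
      case 1
      then have "{b \<in> branches r. y \<in> b} \<subseteq> {b \<in> branches r. x \<in> b}" using branch_down by blast
      then show ?thesis using xy by blast
    next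
      case 2
      then have "{b \<in> branches r. x \<in> b} \<subseteq> {b \<in> branches r. y \<in> b}" using branch_down by blast
      then show ?thesis using xy by blast
    qed
  next
    case (UN K)
    then obtain k where "k \<in> K" "b \<in> k" by blast
    then show ?case using UN by blast
  qed auto
qed

lemma dense_inI:
  assumes "D \<subseteq> branches r" "\<And>x. x \<in> Field r \<Longrightarrow> \<exists>b\<in>D. x \<in> b"
  shows "dense_in (branch_topology r) D"
proof -
  have "b \<in> branch_topology r closure_of D" if b: "b \<in> branches r" for b
    unfolding in_closure_of topspace_branch_topology
  proof (intro conjI b allI impI)
    fix U assume "b \<in> U \<and> openin (branch_topology r) U"
    then obtain x where x: "x \<in> b" "{b \<in> branches r. x \<in> b} \<subseteq> U" using open_contains_node by blast
    then obtain b' where "b' \<in> D" "x \<in> b'" using assms(2) branch_Field[OF b] by blast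
    then show "\<exists>y. y \<in> D \<and> y \<in> U" using x assms(1) by blast
  qed
  moreover have "branch_topology r closure_of D \<subseteq> branches r"
    using closure_of_subset_topspace topspace_branch_topology by metis
  ultimately show ?thesis
    unfolding dense_in_def topspace_branch_topology using assms(1) by blast
qed

text \<open>The neighbourhood of \<open>x\<close> minus the closure of \<open>N\<close> is open and
  nonempty, hence includes the neighbourhood of some node. If that node lies below \<open>x\<close>,
  then \<open>x\<close> itself will do.\<close>

lemma avoid_nowhere_dense:
  assumes N: "nowhere_dense_in (branch_topology r) N" and x: "x \<in> Field r"
  shows "\<exists>y. (x, y) \<in> r \<and> (\<forall>b\<in>branches r. y \<in> b \<longrightarrow> b \<notin> N)"
proof -
  let ?X = "branch_topology r" and ?V = "{b \<in> branches r. x \<in> b}"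
  have "\<not> ?V \<subseteq> ?X closure_of N"
  proof
    assume "?V \<subseteq> ?X closure_of N"
    then have "?V \<subseteq> ?X interior_of (?X closure_of N)"
      using openin_node[OF x] by (rule interior_of_maximal)
    then show False using N branch_through[OF x] unfolding nowhere_dense_in_def by blast
  qed
  then obtain b where b: "b \<in> ?V - ?X closure_of N" by blast
  have "openin ?X (?V - ?X closure_of N)"
    by (intro openin_diff openin_node x closedin_closure_of)
  then obtain y where y: "y \<in> b" "{b \<in> branches r. y \<in> b} \<subseteq> ?V - ?X closure_of N"
    using open_contains_node b by blast
  have NC: "N \<subseteq> ?X closure_of N"
    using N closure_of_subset unfolding nowhere_dense_in_def by blast
  have b': "b \<in> branches r" "x \<in> b" using b by auto
  from branch_comparable[OF b' y(1)] show ?thesis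
  proof
    assume "(x, y) \<in> r"
    then show ?thesis using y(2) NC by blast
  next
    assume yx: "(y, x) \<in> r"
    then have "{b \<in> branches r. x \<in> b} \<subseteq> {b \<in> branches r. y \<in> b}" using branch_down by blast
    then show ?thesis using y(2) NC rel_refl[OF x] by blast
  qed
qed

end

section \<open>Compact sets and filters\<close>

abbreviation cantor :: "(nat \<Rightarrow> bool) topology" where
  "cantor \<equiv> product_topology (\<lambda>_. discrete_topology UNIV) UNIV"

lemma compact_space_cantor: "compact_space cantor"
  by (simp add: compact_space_product_topology compact_space_discrete_topology)

text \<open>A compact product is mapped continuously into a Hausdorff space, since each coordinate
  of the image depends on two bits only. It is used for pointwise meets and for upward
  closures.\<close>

lemma closedin_cantor_image2:
  assumes K: "closedin cantor K" and L: "closedin cantor L"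
  shows "closedin cantor {\<lambda>n. g n (P n) (Q n) |P Q. P \<in> K \<and> Q \<in> L}"
proof -
  let ?h = "\<lambda>z n. g n (fst z n) (snd z n)"
  have "continuous_map (prod_topology cantor cantor) (discrete_topology UNIV) (\<lambda>z. g n (fst z n) (snd z n))" for n
  proof -
    have "continuous_map (prod_topology cantor cantor) (discrete_topology UNIV) (\<lambda>z. fst z n)"
      using continuous_map_compose[OF continuous_map_fst continuous_map_product_projection, of n UNIV]
      by (simp add: o_def)
    moreover have "continuous_map (prod_topology cantor cantor) (discrete_topology UNIV) (\<lambda>z. snd z n)"
      using continuous_map_compose[OF continuous_map_snd continuous_map_product_projection, of n UNIV]
      by (simp add: o_def)
    ultimately have "continuous_map (prod_topology cantor cantor)
        (prod_topology (discrete_topology UNIV) (discrete_topology UNIV)) (\<lambda>z. (fst z n, snd z n))"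
      by (simp add: continuous_map_pairwise o_def)
    then have "continuous_map (prod_topology cantor cantor) (discrete_topology UNIV) (\<lambda>z. (fst z n, snd z n))"
      by (simp add: prod_topology_discrete_topology[symmetric])
    from continuous_map_compose[OF this, of "discrete_topology UNIV" "\<lambda>(a, b). g n a b"]
    show ?thesis by (simp add: o_def)
  qed
  then have cont: "continuous_map (prod_topology cantor cantor) cantor ?h"
    by (simp add: continuous_map_componentwise_UNIV)
  have "compactin cantor K" "compactin cantor L"
    using K L compact_space_cantor closedin_compact_space by blast+
  then have "compactin (prod_topology cantor cantor) (K \<times> L)" by (simp add: compactin_Times)
  then have "compactin cantor (?h ` (K \<times> L))" using cont by (rule image_compactin)
  moreover have "Hausdorff_space cantor" by (simp add: Hausdorff_space_product_topology)
  ultimately have "closedin cantor (?h ` (K \<times> L))" by (simp add: compactin_imp_closedin)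
  moreover have "?h ` (K \<times> L) = {\<lambda>n. g n (P n) (Q n) |P Q. P \<in> K \<and> Q \<in> L}" by force
  ultimately show ?thesis by simp
qed

text \<open>The open sets of all \<open>P\<close> that contain a given \<open>n\<close> cover
  \<open>K\<close>, and a finite subcover bounds \<open>n\<close>. Applied to a closed set of
  members of a proper filter, this gives a finite window of levels.\<close>

lemma closedin_cantor_bounded_hit:
  assumes K: "closedin cantor K" and ne: "\<And>P. P \<in> K \<Longrightarrow> \<exists>n. P n"
  shows "\<exists>h. \<forall>P\<in>K. \<exists>n\<le>h. P n"
proof -
  have "compactin cantor K" using K compact_space_cantor closedin_compact_space by blast
  moreover have "openin cantor {P. P n}" for n
  proof -
    have "openin cantor {P \<in> topspace cantor. P n \<in> {True}}"
      by (rule openin_continuous_map_preimage[OF continuous_map_product_projection[of n]]) auto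
    then show ?thesis by simp
  qed
  moreover have "K \<subseteq> \<Union> (range (\<lambda>n. {P. P n}))" using ne by auto
  ultimately obtain \<F> where \<F>: "finite \<F>" "\<F> \<subseteq> range (\<lambda>n. {P :: nat \<Rightarrow> bool. P n})" "K \<subseteq> \<Union>\<F>"
    unfolding compactin_def by (metis (no_types, lifting) imageE)
  then obtain N where N: "finite N" "\<F> = (\<lambda>n. {P. P n}) ` N" by (meson finite_subset_image)
  obtain h where "\<forall>n\<in>N. n \<le> h" using N(1) finite_nat_set_iff_bounded_le by blast
  then show ?thesis using \<F>(3) N(2) by blast
qed

definition hits :: "nat set \<Rightarrow> (nat \<Rightarrow> bool) set \<Rightarrow> bool" where
  "hits W K \<longleftrightarrow> (\<forall>P\<in>K. \<exists>n\<in>W. P n)"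

text \<open>That finite meets stay in the filter is clear; the point is that all of them lie in one
  closed piece, so that a common finite window exists for them.\<close>

lemma closedin_cantor_meets:
  assumes "finite J" and "\<And>j. j \<in> J \<Longrightarrow> closedin cantor (K j) \<and> K j \<subseteq> {P. eventually P F}"
  shows "\<exists>L. closedin cantor L \<and> L \<subseteq> {P. eventually P F} \<and>
    (\<forall>Y. (\<forall>j\<in>J. Y j \<in> K j) \<longrightarrow> (\<lambda>n. \<forall>j\<in>J. Y j n) \<in> L)"
  using assms
proof (induction rule: finite_induct)
  case empty
  have "Hausdorff_space cantor" by (simp add: Hausdorff_space_product_topology)
  then have "closedin cantor {\<lambda>n. True}" by (intro closedin_Hausdorff_singleton) auto
  then show ?case by (intro exI[of _ "{\<lambda>n. True}"]) auto
next
  case (insert j J)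
  then obtain L where L: "closedin cantor L" "L \<subseteq> {P. eventually P F}"
    "\<And>Y. \<forall>j\<in>J. Y j \<in> K j \<Longrightarrow> (\<lambda>n. \<forall>j\<in>J. Y j n) \<in> L" by auto
  let ?L = "{\<lambda>n. P n \<and> Q n |P Q. P \<in> K j \<and> Q \<in> L}"
  have "closedin cantor ?L"
    using closedin_cantor_image2[of "K j" L "\<lambda>_. (\<and>)"] L(1) insert.prems[of j] by simp
  moreover have "?L \<subseteq> {P. eventually P F}"
    using L(2) insert.prems[of j] by (auto intro!: eventually_conj)
  moreover have "(\<lambda>n. \<forall>j\<in>insert j J. Y j n) \<in> ?L" if "\<forall>j\<in>insert j J. Y j \<in> K j" for Y
    using that L(3)[of Y] by auto
  ultimately show ?case by (intro exI[of _ ?L]) blast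
qed

lemma filter_generated_by_members: "(INF X\<in>{X. eventually (\<lambda>n. n \<in> X) F}. principal X) = F"
proof (rule antisym)
  show "(INF X\<in>{X. eventually (\<lambda>n. n \<in> X) F}. principal X) \<le> F"
  proof (rule filter_leI)
    fix P assume "eventually P F"
    then have "{n. P n} \<in> {X. eventually (\<lambda>n. n \<in> X) F}" by simp
    then have "(INF X\<in>{X. eventually (\<lambda>n. n \<in> X) F}. principal X) \<le> principal {n. P n}" by (rule INF_lower)
    then show "eventually P (INF X\<in>{X. eventually (\<lambda>n. n \<in> X) F}. principal X)"
      by (simp add: le_principal)
  qed
  show "F \<le> (INF X\<in>{X. eventually (\<lambda>n. n \<in> X) F}. principal X)"
    by (intro INF_greatest) (simp add: le_principal)
qed

lemma filter_generated_by_Un: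
  "filter_generated_by ({X. eventually (\<lambda>n. n \<in> X) F} \<union> S) = inf F (INF X\<in>S. principal X)"
  unfolding filter_generated_by_def INF_union filter_generated_by_members ..

lemma eventually_inf_principals:
  "eventually P (inf F (INF X\<in>S. principal X)) \<longleftrightarrow>
    (\<exists>Y E. eventually Y F \<and> finite E \<and> E \<subseteq> S \<and> (\<forall>n. Y n \<longrightarrow> n \<in> \<Inter>E \<longrightarrow> P n))"
proof -
  have *: "(INF X\<in>E. principal X) = principal (\<Inter>E)" if "finite E" for E :: "'a set set"
    using INF_principal_finite[OF that, of "\<lambda>X. X"] by simp
  have **: "eventually Q (INF X\<in>S. principal X) \<longleftrightarrow> (\<exists>E. finite E \<and> E \<subseteq> S \<and> (\<forall>n. n \<in> \<Inter>E \<longrightarrow> Q n))" for Q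
  proof -
    have "eventually Q (INF X\<in>S. principal X) \<longleftrightarrow>
        (\<exists>E. E \<subseteq> S \<and> finite E \<and> eventually Q (INF X\<in>E. principal X))"
      by (rule eventually_INF)
    also have "\<dots> \<longleftrightarrow> (\<exists>E. E \<subseteq> S \<and> finite E \<and> eventually Q (principal (\<Inter>E)))" using * by auto
    finally show ?thesis unfolding eventually_principal by blast
  qed
  show ?thesis
  proof
    assume "eventually P (inf F (INF X\<in>S. principal X))"
    then obtain Y Q E where "eventually Y F" "finite E" "E \<subseteq> S" "\<forall>n. n \<in> \<Inter>E \<longrightarrow> Q n" "\<forall>n. Y n \<and> Q n \<longrightarrow> P n"
      unfolding eventually_inf ** by blast
    then show "\<exists>Y E. eventually Y F \<and> finite E \<and> E \<subseteq> S \<and> (\<forall>n. Y n \<longrightarrow> n \<in> \<Inter>E \<longrightarrow> P n)"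
      by (intro exI[of _ Y] exI[of _ E]) blast
  next
    assume "\<exists>Y E. eventually Y F \<and> finite E \<and> E \<subseteq> S \<and> (\<forall>n. Y n \<longrightarrow> n \<in> \<Inter>E \<longrightarrow> P n)"
    then obtain Y E where YE: "eventually Y F" "finite E" "E \<subseteq> S" "\<forall>n. Y n \<longrightarrow> n \<in> \<Inter>E \<longrightarrow> P n" by blast
    then have "eventually (\<lambda>n. n \<in> \<Inter>E) (INF X\<in>S. principal X)" unfolding ** by blast
    with YE(1,4) show "eventually P (inf F (INF X\<in>S. principal X))" unfolding eventually_inf by blast
  qed
qed

text \<open>The members of the extended filter are the supersets of
  \<open>Y \<inter> \<Inter>E\<close> with \<open>Y\<close> in the old filter and \<open>E\<close> a
  finite subset of \<open>S\<close>. For fixed \<open>E\<close> and \<open>Y\<close> ranging over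
  one closed piece they form a closed set, and there are countably many such choices.\<close>

lemma fsigma_filter_inf_principals:
  assumes F: "fsigma_filter F" and S: "countable S" and ne: "inf F (INF X\<in>S. principal X) \<noteq> bot"
  shows "fsigma_filter (inf F (INF X\<in>S. principal X))"
  unfolding fsigma_filter_def
proof (intro conjI ne)
  obtain K :: "nat \<Rightarrow> (nat \<Rightarrow> bool) set" where K': "\<forall>n. closedin cantor (K n)" and K2: "\<Union> (range K) = {P. eventually P F}"
    using F[unfolded fsigma_filter_def fsigma_in_ascending] by (elim exE conjE)
  note K = K'[rule_format] K2
  \<comment> \<open>The free \<open>Z\<close> produces all supersets, so \<open>L E m\<close> is an
    upward closure, obtained as an image of \<open>K m\<close> times the whole Cantor space.\<close>
  define L where "L E m = {\<lambda>n. Y n \<and> n \<in> \<Inter>E \<or> Z n |Y Z. Y \<in> K m \<and> Z \<in> (UNIV :: (nat \<Rightarrow> bool) set)}" for E m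
  have "closedin cantor (UNIV :: (nat \<Rightarrow> bool) set)" using closedin_topspace[of cantor] by simp
  then have "closedin cantor (L E m)" for E m
    unfolding L_def using closedin_cantor_image2[OF K(1)[of m], of UNIV "\<lambda>n a b. a \<and> n \<in> \<Inter>E \<or> b"] by blast
  moreover have "countable ((\<lambda>(E, m). L E m) ` ({E. finite E \<and> E \<subseteq> S} \<times> UNIV))"
    using S by (intro countable_image countable_SIGMA countable_Collect_finite_subset) auto
  ultimately have "fsigma_in cantor (\<Union> ((\<lambda>(E, m). L E m) ` ({E. finite E \<and> E \<subseteq> S} \<times> UNIV)))"
    by (intro fsigma_in_Union) (auto intro: closed_imp_fsigma_in)
  moreover have "\<Union> ((\<lambda>(E, m). L E m) ` ({E. finite E \<and> E \<subseteq> S} \<times> UNIV)) =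
      {P. eventually P (inf F (INF X\<in>S. principal X))}" (is "?U = ?E")
  proof (rule set_eqI)
    fix P :: "nat \<Rightarrow> bool"
    have extend: "(\<exists>Z. P = (\<lambda>n. Y n \<and> n \<in> \<Inter>E \<or> Z n)) \<longleftrightarrow> (\<forall>n. Y n \<longrightarrow> n \<in> \<Inter>E \<longrightarrow> P n)" for Y E
    proof
      assume "\<exists>Z. P = (\<lambda>n. Y n \<and> n \<in> \<Inter>E \<or> Z n)"
      then show "\<forall>n. Y n \<longrightarrow> n \<in> \<Inter>E \<longrightarrow> P n" by (elim exE) simp
    next
      assume "\<forall>n. Y n \<longrightarrow> n \<in> \<Inter>E \<longrightarrow> P n"
      then have "P = (\<lambda>n. Y n \<and> n \<in> \<Inter>E \<or> P n)" by (intro ext) blast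
      then show "\<exists>Z. P = (\<lambda>n. Y n \<and> n \<in> \<Inter>E \<or> Z n)" by (rule exI[where x = P])
    qed
    have "P \<in> ?U \<longleftrightarrow> (\<exists>E m Y Z. finite E \<and> E \<subseteq> S \<and> Y \<in> K m \<and> P = (\<lambda>n. Y n \<and> n \<in> \<Inter>E \<or> Z n))"
      unfolding L_def by blast
    also have "\<dots> \<longleftrightarrow> (\<exists>E Y Z. finite E \<and> E \<subseteq> S \<and> Y \<in> \<Union> (range K) \<and> P = (\<lambda>n. Y n \<and> n \<in> \<Inter>E \<or> Z n))"
      by blast
    also have "\<dots> \<longleftrightarrow> (\<exists>E Y. finite E \<and> E \<subseteq> S \<and> eventually Y F \<and> (\<exists>Z. P = (\<lambda>n. Y n \<and> n \<in> \<Inter>E \<or> Z n)))"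
      unfolding K(2) by blast
    also have "\<dots> \<longleftrightarrow> (\<exists>E Y. finite E \<and> E \<subseteq> S \<and> eventually Y F \<and> (\<forall>n. Y n \<longrightarrow> n \<in> \<Inter>E \<longrightarrow> P n))"
      unfolding extend ..
    finally have U: "P \<in> ?U \<longleftrightarrow> (\<exists>E Y. finite E \<and> E \<subseteq> S \<and> eventually Y F \<and> (\<forall>n. Y n \<longrightarrow> n \<in> \<Inter>E \<longrightarrow> P n))" .
    show "P \<in> ?U \<longleftrightarrow> P \<in> ?E"
      unfolding U mem_Collect_eq eventually_inf_principals by (subst ex_comm) (simp only: conj_ac)
  qed
  ultimately show "fsigma_in cantor {P. eventually P (inf F (INF X\<in>S. principal X))}" by simp
qed

lemma countably_generated_inf_principals:
  assumes "countably_generated_filter F" "countable S"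
  shows "countably_generated_filter (inf F (INF X\<in>S. principal X))"
proof -
  obtain U :: "nat \<Rightarrow> 'a set" where U: "F = (INF n. principal (U n))"
    using assms(1) unfolding countably_generated_filter_def by blast
  let ?R = "range U \<union> S"
  have "range (from_nat_into ?R) = ?R" using assms(2) by (intro range_from_nat_into) auto
  then have "(INF X\<in>?R. principal X) = (INF X\<in>range (from_nat_into ?R). principal X)" by simp
  also have "\<dots> = (INF n. principal (from_nat_into ?R n))" by (simp only: image_image)
  finally have "(INF X\<in>?R. principal X) = (INF n. principal (from_nat_into ?R n))" .
  moreover have "inf F (INF X\<in>S. principal X) = (INF X\<in>?R. principal X)"
    unfolding U INF_union by (simp only: image_image)
  ultimately have "inf F (INF X\<in>S. principal X) = (INF n. principal (from_nat_into ?R n))"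
    by simp
  then show ?thesis unfolding countably_generated_filter_def by blast
qed

section \<open>Fusion of branches\<close>

definition tle :: "('i \<Rightarrow> 'a rel) \<Rightarrow> 'i \<Rightarrow> 'a \<Rightarrow> 'a \<Rightarrow> bool" where
  "tle T i x y \<longleftrightarrow> (x, y) \<in> T i"

definition slice :: "'i set \<Rightarrow> ('i \<Rightarrow> 'a rel) \<Rightarrow> ('i \<Rightarrow> 'a) \<Rightarrow> nat \<Rightarrow> 'i \<Rightarrow> 'a" where
  "slice I T q n = (\<lambda>i\<in>I. omega_tree.anc (T i) (q i) n)"

text \<open>The pattern \<open>c\<close> on \<open>G\<close> can be copied, by raising nodes, onto all levels of a set that meets
  every member of a prescribed compact part of the filter.\<close>

definition realizes ::
  "'i set \<Rightarrow> ('i \<Rightarrow> 'a rel) \<Rightarrow> (('i \<Rightarrow> 'a) \<Rightarrow> 'c) \<Rightarrow> nat filter \<Rightarrow> ('i \<Rightarrow> 'a) set \<Rightarrow> (('i \<Rightarrow> 'a) \<Rightarrow> 'c) \<Rightarrow> bool" where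
  "realizes I T f F G c \<longleftrightarrow> (\<forall>K. closedin cantor K \<longrightarrow> K \<subseteq> {P. eventually P F} \<longrightarrow>
    (\<exists>\<phi>\<in>inflations I (\<lambda>i. Field (T i)) (tle T). \<exists>W. hits W K \<and>
      (\<forall>n\<in>W. \<forall>q\<in>G. (\<forall>i\<in>I. n \<le> omega_tree.ht (T i) (app I \<phi> q i)) \<and>
        f (slice I T (app I \<phi> q) n) = c q)))"

lemma realizes_cong: "realizes I T f F G c \<Longrightarrow> (\<And>q. q \<in> G \<Longrightarrow> c q = c' q) \<Longrightarrow> realizes I T f F G c'"
  unfolding realizes_def by simp

lemma realizes_mono: "realizes I T f F G c \<Longrightarrow> G' \<subseteq> G \<Longrightarrow> realizes I T f F G' c"
  unfolding realizes_def by (meson subsetD)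

locale tree_family =
  fixes I :: "'i set" and T :: "'i \<Rightarrow> 'a rel" and A :: "'c set" and f :: "('i \<Rightarrow> 'a) \<Rightarrow> 'c"
    and F :: "nat filter"
  assumes fin: "finite I" and trees: "\<And>i. i \<in> I \<Longrightarrow> omega_tree (T i)" and finA: "finite A"
    and f: "f \<in> (\<Union>l. PiE I (\<lambda>i. tree_level (T i) l)) \<rightarrow> A" and F: "F \<noteq> bot"
begin

abbreviation "nodes i \<equiv> Field (T i)"
abbreviation "le \<equiv> tle T"
abbreviation "height i \<equiv> omega_tree.ht (T i)"
abbreviation "B \<equiv> PiE I nodes"

lemma pre: "preorders I nodes le"
  unfolding preorders_def
proof (intro ballI conjI impI)
  fix i assume i: "i \<in> I"
  show "nodes i \<noteq> {}" using omega_tree.Field_nonempty[OF trees[OF i]] .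
  show "countable (nodes i)" using omega_tree.countable_Field[OF trees[OF i]] .
  show "le i x x" if "x \<in> nodes i" for x
    using omega_tree.rel_refl[OF trees[OF i] that] by (simp add: tle_def)
  show "le i x z" if "le i x y" "le i y z" for x y z
    using omega_tree.rel_trans[OF trees[OF i]] that unfolding tle_def by blast
qed

lemma slice_colour:
  assumes q: "q \<in> B" and n: "\<And>i. i \<in> I \<Longrightarrow> n \<le> height i (q i)"
  shows "f (slice I T q n) \<in> A"
proof (rule funcset_mem[OF f])
  have "slice I T q n \<in> PiE I (\<lambda>i. tree_level (T i) n)"
    unfolding slice_def
  proof (rule restrict_PiE_iff[THEN iffD2], rule ballI)
    fix i assume i: "i \<in> I"
    show "omega_tree.anc (T i) (q i) n \<in> tree_level (T i) n"
      using omega_tree.anc_level[OF trees[OF i] PiE_mem[OF q i] n[OF i]] .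
  qed
  then show "slice I T q n \<in> (\<Union>l. PiE I (\<lambda>i. tree_level (T i) l))" by blast
qed

section \<open>Copying colour patterns onto levels\<close>

text \<open>Otherwise each of the finitely many patterns \<open>c\<close> is refuted by a closed
  piece \<open>K c\<close> of the filter. Meets of members of these pieces all reach into a common
  window of levels up to \<open>h\<close>. But choosing from each \<open>K c\<close> a member that
  misses the levels of pattern \<open>c\<close> gives a meet that misses the whole window.\<close>

lemma pattern_realized:
  assumes G: "finite G" "G \<subseteq> B"
  shows "\<exists>c\<in>PiE G (\<lambda>_. A). realizes I T f F G c"
proof (rule ccontr)
  define bad where "bad K c \<longleftrightarrow> (\<exists>\<phi>\<in>inflations I nodes le. \<exists>W. hits W K \<and>
      (\<forall>n\<in>W. \<forall>q\<in>G. (\<forall>i\<in>I. n \<le> height i (app I \<phi> q i)) \<and> f (slice I T (app I \<phi> q) n) = c q))"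
    for K and c :: "('i \<Rightarrow> 'a) \<Rightarrow> 'c"
  let ?P = "PiE G (\<lambda>_. A)"
  assume "\<not> ?thesis"
  then have "\<forall>c\<in>?P. \<exists>K. closedin cantor K \<and> K \<subseteq> {P. eventually P F} \<and> \<not> bad K c"
    unfolding realizes_def bad_def[symmetric] by blast
  then obtain K where K: "\<And>c. c \<in> ?P \<Longrightarrow> closedin cantor (K c) \<and> K c \<subseteq> {P. eventually P F}"
    and bad: "\<And>c. c \<in> ?P \<Longrightarrow> \<not> bad (K c) c"
    by (metis (no_types, lifting) bchoice)
  have finP: "finite ?P" using G(1) finA by (intro finite_PiE) auto
  from closedin_cantor_meets[of ?P K F, OF finP K] obtain L where
    L: "closedin cantor L" "L \<subseteq> {P. eventually P F}"
    "\<And>Y. \<forall>c\<in>?P. Y c \<in> K c \<Longrightarrow> (\<lambda>n. \<forall>c\<in>?P. Y c n) \<in> L" by blast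
  have "\<exists>n. P n" if "P \<in> L" for P
    using L(2) that F eventually_happens[of P F] by (auto simp: trivial_limit_def)
  from closedin_cantor_bounded_hit[OF L(1) this] obtain h where h: "\<forall>P\<in>L. \<exists>n\<le>h. P n" by blast
  \<comment> \<open>All nodes go above \<open>h\<close> before any pattern is considered, so one
    inflation serves all patterns and all levels of the window.\<close>
  define \<phi> where "\<phi> i x = (SOME y. (x, y) \<in> T i \<and> h \<le> height i y)" for i x
  have \<phi>: "(x, \<phi> i x) \<in> T i \<and> h \<le> height i (\<phi> i x)" if "i \<in> I" "x \<in> nodes i" for i x
    unfolding \<phi>_def using omega_tree.high_above[OF trees[OF that(1)] that(2)] by (rule someI_ex)
  have infl: "\<phi> \<in> inflations I nodes le"
    unfolding inflations_def tle_def using \<phi> by (auto intro: FieldI2)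
  have high: "n \<le> height i (app I \<phi> q i)" if "n \<le> h" "q \<in> G" "i \<in> I" for n q i
  proof -
    have "q i \<in> nodes i" using G(2) that(2,3) by auto
    then show ?thesis using \<phi>[OF that(3)] that(1,3) by (fastforce simp: app_def)
  qed
  define pat where "pat n = (\<lambda>q\<in>G. f (slice I T (app I \<phi> q) n))" for n
  have pat: "pat n \<in> ?P" if "n \<le> h" for n
    unfolding pat_def
  proof (rule restrict_PiE_iff[THEN iffD2], rule ballI)
    fix q assume q: "q \<in> G"
    show "f (slice I T (app I \<phi> q) n) \<in> A"
      using app_in[OF infl] q G(2) high[OF that q] by (intro slice_colour) blast+
  qed
  \<comment> \<open>If every member of \<open>K c\<close> met the levels with pattern
    \<open>c\<close>, then these levels together with \<open>\<phi>\<close> would realize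
    \<open>c\<close> for \<open>K c\<close>.\<close>
  have "\<exists>Y\<in>K c. \<forall>n. n \<le> h \<longrightarrow> pat n = c \<longrightarrow> \<not> Y n" if c: "c \<in> ?P" for c
  proof (rule ccontr)
    assume "\<not> ?thesis"
    then have "hits {n. n \<le> h \<and> pat n = c} (K c)" unfolding hits_def by blast
    moreover have "\<forall>n\<in>{n. n \<le> h \<and> pat n = c}. \<forall>q\<in>G. (\<forall>i\<in>I. n \<le> height i (app I \<phi> q i)) \<and>
        f (slice I T (app I \<phi> q) n) = c q"
      using high by (auto simp: pat_def)
    ultimately have "bad (K c) c" unfolding bad_def using infl by blast
    then show False using bad[OF c] by blast
  qed
  then obtain Y where Y: "\<And>c. c \<in> ?P \<Longrightarrow> Y c \<in> K c \<and> (\<forall>n. n \<le> h \<longrightarrow> pat n = c \<longrightarrow> \<not> Y c n)"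
    by metis
  have "(\<lambda>n. \<forall>c\<in>?P. Y c n) \<in> L" by (rule L(3)) (simp add: Y)
  from bspec[OF h this] obtain n where n: "n \<le> h" "\<forall>c\<in>?P. Y c n" by (elim exE conjE)
  show False using Y[OF pat[OF n(1)]] n bspec[OF n(2) pat[OF n(1)]] by simp
qed

text \<open>Realizing every finite pattern is a condition on finite restrictions, hence closed. It
  is satisfiable, by a cluster point of patterns on an exhaustion, and invariant under inflations.
  The partition theorem then yields a member that is constant on a cofinal set of cones.\<close>

lemma generic_colouring:
  "\<exists>c. c \<in> B \<rightarrow> A \<and> (\<forall>G. finite G \<longrightarrow> G \<subseteq> B \<longrightarrow> realizes I T f F G c) \<and>
    (\<forall>s\<in>B. \<exists>t\<in>B. (\<forall>i\<in>I. le i (s i) (t i)) \<and> (\<exists>a. \<forall>x\<in>PiE I (upper_cone nodes le t). c x = a))"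
proof -
  define CC where "CC = {c \<in> B \<times> {()} \<rightarrow> A. \<forall>G. finite G \<longrightarrow> G \<subseteq> B \<longrightarrow> realizes I T f F G (\<lambda>q. c (q, ()))}"
  have CCD: "realizes I T f F G (\<lambda>q. c (q, ()))" if "c \<in> CC" "finite G" "G \<subseteq> B" for c G
    using that unfolding CC_def by simp
  have CCf: "c \<in> B \<times> {()} \<rightarrow> A" if "c \<in> CC" for c
    using that unfolding CC_def by simp
  have Ane: "A \<noteq> {}"
  proof -
    have "B \<noteq> {}" using preorders_nonempty[OF pre] by (auto simp: PiE_eq_empty_iff)
    then obtain q where q: "q \<in> B" by blast
    have "f (slice I T q 0) \<in> A" by (rule slice_colour[OF q]) simp
    then show ?thesis by blast
  qed
  have ne: "CC \<noteq> {}"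
  proof -
    let ?G = "\<lambda>m. PiE I (exhaustion nodes m)"
    have G: "finite (?G m)" "?G m \<subseteq> B" for m
      using finite_family_PiE[OF fin] finite_family_mono exhaustion_finite_family[OF pre] by blast+
    have "\<exists>c. c \<in> B \<rightarrow> A \<and> realizes I T f F (?G m) c" for m
    proof -
      obtain c where c: "c \<in> PiE (?G m) (\<lambda>_. A)" "realizes I T f F (?G m) c"
        using pattern_realized[OF G[of m]] by (elim bexE)
      obtain a where a: "a \<in> A" using Ane by blast
      \<comment> \<open>The colour \<open>a\<close> off \<open>?G m\<close> is arbitrary; it only
        completes the pattern to a colouring of all of \<open>B\<close>.\<close>
      let ?c = "\<lambda>q. if q \<in> ?G m then c q else a"
      have "?c \<in> B \<rightarrow> A" using PiE_mem[OF c(1)] a by (intro funcsetI) simp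
      moreover have "realizes I T f F (?G m) ?c" using realizes_cong[OF c(2)] by simp
      ultimately show ?thesis by (intro exI[of _ ?c] conjI)
    qed
    then obtain c where c: "\<And>m. c m \<in> B \<rightarrow> A" "\<And>m. realizes I T f F (?G m) (c m)" by metis
    note colouring_limit[of B A c, OF countable_PiE_preorders[OF fin pre] finA c(1)]
    then obtain e where e: "e \<in> B \<rightarrow> A"
      "\<forall>G. finite G \<longrightarrow> G \<subseteq> B \<longrightarrow> infinite {n. \<forall>x\<in>G. c n x = e x}" by (elim bexE)
    have "realizes I T f F G e" if GB: "finite G" "G \<subseteq> B" for G
    proof -
      obtain m where m: "\<And>n. n \<ge> m \<Longrightarrow> G \<subseteq> ?G n" using exhaustion_covers[OF fin pre GB] by blast
      have "infinite {n. \<forall>x\<in>G. c n x = e x}" using e(2) GB by simp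
      then obtain n where n: "n \<ge> m" "\<forall>x\<in>G. c n x = e x" by (rule infinite_natE)
      show ?thesis using realizes_cong[OF realizes_mono[OF c(2) m[OF n(1)]]] n(2) by simp
    qed
    then have "(\<lambda>(q, u). e q) \<in> CC" using e(1) unfolding CC_def by auto
    then show ?thesis by blast
  qed
  have space: "colouring_space I nodes le {()} A CC"
    unfolding colouring_space_def
  proof (intro conjI ballI impI ne)
    show "CC \<subseteq> B \<times> {()} \<rightarrow> A" using CCf by blast
  next
    fix e assume e: "e \<in> B \<times> {()} \<rightarrow> A"
      and app: "\<forall>G. finite G \<longrightarrow> G \<subseteq> B \<times> {()} \<longrightarrow> (\<exists>c\<in>CC. \<forall>x\<in>G. c x = e x)"
    have "realizes I T f F G (\<lambda>q. e (q, ()))" if G: "finite G" "G \<subseteq> B" for G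
    proof -
      have "finite (G \<times> {()})" "G \<times> {()} \<subseteq> B \<times> {()}" using G by auto
      then obtain c where c: "c \<in> CC" "\<forall>x\<in>G \<times> {()}. c x = e x" using app by meson
      show ?thesis using realizes_cong[OF CCD[OF c(1) G]] c(2) by simp
    qed
    then show "e \<in> CC" using e unfolding CC_def by simp
  next
    fix c \<phi> assume c: "c \<in> CC" and \<phi>: "\<phi> \<in> inflations I nodes le"
    have "realizes I T f F G (\<lambda>q. c (app I \<phi> q, ()))" if G: "finite G" "G \<subseteq> B" for G
    proof -
      \<comment> \<open>If \<open>\<psi>\<close> copies \<open>c\<close> on the image of
        \<open>G\<close> under \<open>\<phi>\<close>, then \<open>\<phi>\<close> followed by
        \<open>\<psi>\<close> copies the raised colouring on \<open>G\<close>.\<close>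
      have "app I \<phi> ` G \<subseteq> B" by (intro image_subsetI app_in[OF \<phi>]) (erule subsetD[OF G(2)])
      from CCD[OF c finite_imageI[OF G(1)] this]
      have r: "realizes I T f F (app I \<phi> ` G) (\<lambda>q. c (q, ()))" .
      show ?thesis
        unfolding realizes_def
      proof (intro allI impI)
        fix K assume "closedin cantor K" "K \<subseteq> {P. eventually P F}"
        then obtain \<psi> W where \<psi>: "\<psi> \<in> inflations I nodes le" "hits W K"
          "\<forall>n\<in>W. \<forall>q\<in>app I \<phi> ` G. (\<forall>i\<in>I. n \<le> height i (app I \<psi> q i)) \<and>
            f (slice I T (app I \<psi> q) n) = c (q, ())"
          using r unfolding realizes_def by meson
        show "\<exists>\<phi>'\<in>inflations I nodes le. \<exists>W. hits W K \<and>
          (\<forall>n\<in>W. \<forall>q\<in>G. (\<forall>i\<in>I. n \<le> height i (app I \<phi>' q i)) \<and>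
            f (slice I T (app I \<phi>' q) n) = c (app I \<phi> q, ()))"
          using inflations_comp[OF pre \<phi> \<psi>(1)] \<psi>(2,3)
          by (intro bexI[of _ "\<lambda>i x. \<psi> i (\<phi> i x)"] exI[of _ W]) (simp_all add: app_comp)
      qed
    qed
    moreover have "(\<lambda>(x, y). c (app I \<phi> x, y)) \<in> B \<times> {()} \<rightarrow> A"
    proof (rule funcsetI)
      fix z :: "('i \<Rightarrow> 'a) \<times> unit" assume "z \<in> B \<times> {()}"
      then have "fst z \<in> B" by (simp add: mem_Times_iff)
      then have "(app I \<phi> (fst z), ()) \<in> B \<times> {()}" using app_in[OF \<phi>] by simp
      then show "(case z of (x, y) \<Rightarrow> c (app I \<phi> x, y)) \<in> A"
        using funcset_mem[OF CCf[OF c]] by (simp add: case_prod_beta)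
    qed
    ultimately show "(\<lambda>(x, y). c (app I \<phi> x, y)) \<in> CC" unfolding CC_def by simp
  qed
  have "\<exists>c\<in>CC. \<forall>s\<in>B. \<forall>y\<in>{()}. \<exists>t\<in>B. (\<forall>i\<in>I. le i (s i) (t i)) \<and>
      (\<exists>a. \<forall>x\<in>PiE I (upper_cone nodes le t). c (x, y) = a)"
    by (rule colouring_space_locally_constant[OF fin pre _ finA space])
      (simp, rule Halpern_Laeuchli_preorders[OF fin preorders_upper_cone[OF pre] finA])
  then obtain c where c: "c \<in> CC" "\<forall>s\<in>B. \<forall>y\<in>{()}. \<exists>t\<in>B. (\<forall>i\<in>I. le i (s i) (t i)) \<and>
      (\<exists>a. \<forall>x\<in>PiE I (upper_cone nodes le t). c (x, y) = a)"
    by (elim bexE)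
  show ?thesis
  proof (intro exI[of _ "\<lambda>q. c (q, ())"] conjI allI impI ballI)
    show "(\<lambda>q. c (q, ())) \<in> B \<rightarrow> A" using funcset_mem[OF CCf[OF c(1)]] by simp
    show "realizes I T f F G (\<lambda>q. c (q, ()))" if "finite G" "G \<subseteq> B" for G using CCD[OF c(1) that] .
    show "\<exists>t\<in>B. (\<forall>i\<in>I. le i (s i) (t i)) \<and> (\<exists>a. \<forall>x\<in>PiE I (upper_cone nodes le t). c (x, ()) = a)"
      if "s \<in> B" for s using c(2)[THEN bspec, OF that] by simp
  qed
qed


section \<open>The fusion sequence\<close>

text \<open>\<open>t i k\<close> is the current node of the \<open>k\<close>-th branch under
  construction in the tree \<open>T i\<close>; \<open>\<kappa>\<close> selects one of these branches
  in each tree.\<close>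

definition tup :: "('i \<Rightarrow> nat \<Rightarrow> 'a) \<Rightarrow> ('i \<Rightarrow> nat) \<Rightarrow> 'i \<Rightarrow> 'a" where
  "tup t \<kappa> = (\<lambda>i\<in>I. t i (\<kappa> i))"

lemma tup_in: "(\<And>i k. i \<in> I \<Longrightarrow> t i k \<in> nodes i) \<Longrightarrow> tup t \<kappa> \<in> B"
  unfolding tup_def by (simp add: restrict_PiE_iff)

lemma app_tup: "app I \<phi> (tup t \<kappa>) = tup (\<lambda>i k. \<phi> i (t i k)) \<kappa>"
  unfolding tup_def app_def by auto

text \<open>Three raisings in this order: \<open>t1\<close> gains height and leaves
  \<open>M\<close>, \<open>t2\<close> settles the finitely many tuples with indices below
  \<open>N\<close>, \<open>t3\<close> copies their colours onto levels. Settling has to precede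
  copying: \<open>realizes\<close> gives the raised tuples the colours that \<open>c\<close> had
  before raising, and only settledness turns these into the colours of \<open>t3\<close>.\<close>

lemma fusion_step:
  assumes real: "\<forall>G. finite G \<longrightarrow> G \<subseteq> B \<longrightarrow> realizes I T f F G c"
    and dense: "\<forall>s\<in>B. \<exists>t\<in>B. (\<forall>i\<in>I. le i (s i) (t i)) \<and> (\<exists>a. \<forall>x\<in>PiE I (upper_cone nodes le t). c x = a)"
    and nd: "\<forall>i\<in>I. nowhere_dense_in (branch_topology (T i)) (M i)"
    and K: "closedin cantor K" "K \<subseteq> {P. eventually P F}"
    and t: "\<forall>i\<in>I. \<forall>k. t i k \<in> nodes i"
  shows "\<exists>t'. (\<forall>i\<in>I. \<forall>k. (t i k, t' i k) \<in> T i \<and> N \<le> height i (t' i k) \<and>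
        (\<forall>b\<in>branches (T i). t' i k \<in> b \<longrightarrow> b \<notin> M i)) \<and>
      (\<forall>\<kappa>\<in>PiE I (\<lambda>_. {..<N}). settled I nodes le c (tup t' \<kappa>)) \<and>
      (\<exists>W. hits W K \<and> (\<forall>n\<in>W. \<forall>\<kappa>\<in>PiE I (\<lambda>_. {..<N}).
        (\<forall>i\<in>I. n \<le> height i (t' i (\<kappa> i))) \<and> f (slice I T (tup t' \<kappa>) n) = c (tup t' \<kappa>)))"
proof -
  let ?Ks = "PiE I (\<lambda>_. {..<N})"
  have finK: "finite ?Ks" using fin by (intro finite_PiE) auto
  have "\<exists>y. (x, y) \<in> T i \<and> N \<le> height i y \<and> (\<forall>b\<in>branches (T i). y \<in> b \<longrightarrow> b \<notin> M i)"
    if i: "i \<in> I" and x: "x \<in> nodes i" for i x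
  proof -
    obtain y where y: "(x, y) \<in> T i" "\<forall>b\<in>branches (T i). y \<in> b \<longrightarrow> b \<notin> M i"
      using omega_tree.avoid_nowhere_dense[OF trees[OF i] bspec[OF nd i] x] by blast
    obtain z where z: "(y, z) \<in> T i" "N \<le> height i z"
      using omega_tree.high_above[OF trees[OF i] FieldI2[OF y(1)]] by blast
    have "(x, z) \<in> T i" using omega_tree.rel_trans[OF trees[OF i] y(1) z(1)] .
    moreover have "\<forall>b\<in>branches (T i). z \<in> b \<longrightarrow> b \<notin> M i"
      using y(2) omega_tree.branch_down[OF trees[OF i] _ _ z(1)] by blast
    ultimately show ?thesis using z(2) by blast
  qed
  then obtain \<phi> where \<phi>: "\<And>i x. i \<in> I \<Longrightarrow> x \<in> nodes i \<Longrightarrow> (x, \<phi> i x) \<in> T i \<and> N \<le> height i (\<phi> i x) \<and>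
      (\<forall>b\<in>branches (T i). \<phi> i x \<in> b \<longrightarrow> b \<notin> M i)" by metis
  have infl1: "\<phi> \<in> inflations I nodes le"
    unfolding inflations_def tle_def using \<phi> by (auto intro: FieldI2)
  define t1 where "t1 = (\<lambda>i k. \<phi> i (t i k))"
  have t1: "t1 i k \<in> nodes i" if "i \<in> I" for i k
    using infl1 t that unfolding t1_def inflations_def by blast
  have "tup t1 ` ?Ks \<subseteq> B" using tup_in[of t1, OF t1] by blast
  with settle_finite[OF pre finite_imageI[OF finK], of "tup t1" c] dense
  have "\<exists>\<psi>\<in>inflations I nodes le. \<forall>q\<in>tup t1 ` ?Ks. settled I nodes le c (app I \<psi> q)"
    by simp
  then obtain \<psi> where \<psi>: "\<psi> \<in> inflations I nodes le" "\<forall>q\<in>tup t1 ` ?Ks. settled I nodes le c (app I \<psi> q)"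
    by (elim bexE)
  define t2 where "t2 = (\<lambda>i k. \<psi> i (t1 i k))"
  have t2: "t2 i k \<in> nodes i" if "i \<in> I" for i k
    using \<psi>(1) t1[OF that] that unfolding t2_def inflations_def by blast
  have set2: "settled I nodes le c (tup t2 \<kappa>)" if "\<kappa> \<in> ?Ks" for \<kappa>
    using \<psi>(2) that unfolding t2_def by (simp add: app_tup)
  have "tup t2 ` ?Ks \<subseteq> B" using tup_in[of t2, OF t2] by blast
  with real finK have "realizes I T f F (tup t2 ` ?Ks) c" by simp
  from this[unfolded realizes_def, rule_format, OF K]
  obtain \<rho> W where \<rho>: "\<rho> \<in> inflations I nodes le" "hits W K"
    "\<forall>n\<in>W. \<forall>q\<in>tup t2 ` ?Ks. (\<forall>i\<in>I. n \<le> height i (app I \<rho> q i)) \<and> f (slice I T (app I \<rho> q) n) = c q"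
    by (elim bexE exE conjE)
  define t3 where "t3 = (\<lambda>i k. \<rho> i (t2 i k))"
  have t3: "t3 i k \<in> nodes i" if "i \<in> I" for i k
    using \<rho>(1) t2[OF that] that unfolding t3_def inflations_def by blast
  have t23: "le i (t2 i k) (t3 i k)" if "i \<in> I" for i k
    using \<rho>(1) t2[OF that] that unfolding t3_def inflations_def by blast
  have t13: "(t1 i k, t3 i k) \<in> T i" if i: "i \<in> I" for i k
  proof -
    have "(t1 i k, t2 i k) \<in> T i"
      using \<psi>(1) t1[OF i] i unfolding t2_def inflations_def tle_def by blast
    then show ?thesis using omega_tree.rel_trans[OF trees[OF i]] t23[OF i, of k] unfolding tle_def by blast
  qed
  have set3: "settled I nodes le c (tup t3 \<kappa>) \<and> c (tup t3 \<kappa>) = c (tup t2 \<kappa>)" if "\<kappa> \<in> ?Ks" for \<kappa>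
    using settled_upward[OF pre tup_in[of t2, OF t2] set2[OF that] tup_in[of t3, OF t3]] t23
    by (simp add: tup_def)
  show ?thesis
  proof (intro exI[of _ t3] exI[of _ W] conjI ballI allI)
    fix i k assume i: "i \<in> I"
    have p: "(t i k, t1 i k) \<in> T i" "N \<le> height i (t1 i k)" "\<forall>b\<in>branches (T i). t1 i k \<in> b \<longrightarrow> b \<notin> M i"
      using \<phi>[OF i t[rule_format, OF i]] unfolding t1_def by blast+
    show "(t i k, t3 i k) \<in> T i" using omega_tree.rel_trans[OF trees[OF i] p(1) t13[OF i]] .
    show "N \<le> height i (t3 i k)" using omega_tree.ht_mono[OF trees[OF i] t13[OF i], of k] p(2) by linarith
    fix b assume b: "b \<in> branches (T i)"
    show "t3 i k \<in> b \<longrightarrow> b \<notin> M i"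
      using omega_tree.branch_down[OF trees[OF i] b _ t13[OF i]] p(3) b by blast
  next
    fix \<kappa> assume "\<kappa> \<in> ?Ks"
    then show "settled I nodes le c (tup t3 \<kappa>)" using set3 by blast
  next
    show "hits W K" by fact
  next
    fix n \<kappa> i assume n: "n \<in> W" and \<kappa>: "\<kappa> \<in> ?Ks" and i: "i \<in> I"
    have "n \<le> height i (app I \<rho> (tup t2 \<kappa>) i)" using \<rho>(3) n \<kappa> i by blast
    then show "n \<le> height i (t3 i (\<kappa> i))" using i by (simp add: app_def tup_def t3_def)
  next
    fix n \<kappa> assume n: "n \<in> W" and \<kappa>: "\<kappa> \<in> ?Ks"
    have "f (slice I T (app I \<rho> (tup t2 \<kappa>)) n) = c (tup t2 \<kappa>)" using \<rho>(3) n \<kappa> by blast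
    then show "f (slice I T (tup t3 \<kappa>) n) = c (tup t3 \<kappa>)"
      using set3[OF \<kappa>] by (simp add: app_tup t3_def)
  qed
qed

text \<open>Stage \<open>0\<close> enumerates all nodes, which will make the limit branches dense.
  Stage \<open>Suc N\<close> serves the requirements numbered \<open>N\<close>: the set
  \<open>M i N\<close> and the height \<open>N\<close> for all branches, and the piece
  \<open>K N\<close> for the finitely many tuples with indices below \<open>N\<close>.\<close>

definition fusion ::
  "(('i \<Rightarrow> 'a) \<Rightarrow> 'c) \<Rightarrow> ('i \<Rightarrow> nat \<Rightarrow> 'a set set) \<Rightarrow> (nat \<Rightarrow> (nat \<Rightarrow> bool) set) \<Rightarrow> (nat \<Rightarrow> 'i \<Rightarrow> nat \<Rightarrow> 'a) \<Rightarrow> bool" where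
  "fusion c M K t \<longleftrightarrow> (\<forall>i\<in>I. \<forall>k. t 0 i k = from_nat_into (nodes i) k) \<and>
    (\<forall>N. (\<forall>i\<in>I. \<forall>k. (t N i k, t (Suc N) i k) \<in> T i \<and> N \<le> height i (t (Suc N) i k) \<and>
        (\<forall>b\<in>branches (T i). t (Suc N) i k \<in> b \<longrightarrow> b \<notin> M i N)) \<and>
      (\<forall>\<kappa>\<in>PiE I (\<lambda>_. {..<N}). settled I nodes le c (tup (t (Suc N)) \<kappa>)) \<and>
      (\<exists>W. hits W (K N) \<and> (\<forall>n\<in>W. \<forall>\<kappa>\<in>PiE I (\<lambda>_. {..<N}).
        (\<forall>i\<in>I. n \<le> height i (t (Suc N) i (\<kappa> i))) \<and>
        f (slice I T (tup (t (Suc N)) \<kappa>) n) = c (tup (t (Suc N)) \<kappa>))))"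

lemma fusion_exists:
  assumes real: "\<forall>G. finite G \<longrightarrow> G \<subseteq> B \<longrightarrow> realizes I T f F G c"
    and dense: "\<forall>s\<in>B. \<exists>t\<in>B. (\<forall>i\<in>I. le i (s i) (t i)) \<and> (\<exists>a. \<forall>x\<in>PiE I (upper_cone nodes le t). c x = a)"
    and nd: "\<forall>N. \<forall>i\<in>I. nowhere_dense_in (branch_topology (T i)) (M i N)"
    and K: "\<And>N. closedin cantor (K N)" "\<And>N. K N \<subseteq> {P. eventually P F}"
  shows "\<exists>t. fusion c M K t"
proof -
  define R where "R N t t' \<longleftrightarrow> (\<forall>i\<in>I. \<forall>k. (t i k, t' i k) \<in> T i \<and> N \<le> height i (t' i k) \<and>
        (\<forall>b\<in>branches (T i). t' i k \<in> b \<longrightarrow> b \<notin> M i N)) \<and>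
      (\<forall>\<kappa>\<in>PiE I (\<lambda>_. {..<N}). settled I nodes le c (tup t' \<kappa>)) \<and>
      (\<exists>W. hits W (K N) \<and> (\<forall>n\<in>W. \<forall>\<kappa>\<in>PiE I (\<lambda>_. {..<N}).
        (\<forall>i\<in>I. n \<le> height i (t' i (\<kappa> i))) \<and> f (slice I T (tup t' \<kappa>) n) = c (tup t' \<kappa>)))" for N t t'
  \<comment> \<open>The start condition is part of the invariant, guarded by \<open>N = 0\<close>,
    because dependent choice does not fix the initial value.\<close>
  define P where "P N t \<longleftrightarrow> (\<forall>i\<in>I. \<forall>k. t i k \<in> nodes i \<and> (N = 0 \<longrightarrow> t i k = from_nat_into (nodes i) k))" for N :: nat and t
  have "\<exists>t. \<forall>N. P N (t N) \<and> R N (t N) (t (Suc N))"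
  proof (rule dependent_nat_choice)
    show "\<exists>t. P 0 t"
      unfolding P_def using from_nat_into[OF preorders_nonempty[OF pre]]
      by (intro exI[of _ "\<lambda>i k. from_nat_into (nodes i) k"]) simp
  next
    fix t and N :: nat assume t: "P N t"
    then have "\<forall>i\<in>I. \<forall>k. t i k \<in> nodes i" by (simp add: P_def)
    from fusion_step[OF real dense spec[OF nd] K this, of N N N]
    obtain t' where t': "R N t t'" unfolding R_def by (elim exE)
    have "t' i k \<in> nodes i" if "i \<in> I" for i k
      using FieldI2[OF conjunct1[OF spec[OF bspec[OF conjunct1[OF t'[unfolded R_def]] that]]]] .
    then have "P (Suc N) t'" by (simp add: P_def)
    with t' show "\<exists>t'. P (Suc N) t' \<and> R N t t'" by blast
  qed
  then obtain t where t: "\<forall>N. P N (t N) \<and> R N (t N) (t (Suc N))" by (elim exE)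
  have "\<forall>i\<in>I. \<forall>k. t 0 i k = from_nat_into (nodes i) k" using conjunct1[OF spec[OF t, of 0]] by (simp add: P_def)
  moreover have "\<forall>N. R N (t N) (t (Suc N))" using t by blast
  ultimately show ?thesis unfolding fusion_def R_def by (intro exI[of _ t] conjI)
qed

section \<open>Limit branches and their colours\<close>

definition limit_branch :: "(nat \<Rightarrow> 'i \<Rightarrow> nat \<Rightarrow> 'a) \<Rightarrow> 'i \<Rightarrow> nat \<Rightarrow> 'a set" where
  "limit_branch t i k = {x. \<exists>N. (x, t N i k) \<in> T i}"

definition level_tuple :: "('i \<Rightarrow> 'a set) \<Rightarrow> nat \<Rightarrow> 'i \<Rightarrow> 'a" where
  "level_tuple b n = (\<lambda>i\<in>I. branch_node (T i) (b i) n)"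

lemma fusion_stage:
  assumes "fusion c M K t"
  shows "\<forall>i\<in>I. \<forall>k. (t N i k, t (Suc N) i k) \<in> T i \<and> N \<le> height i (t (Suc N) i k) \<and>
        (\<forall>b\<in>branches (T i). t (Suc N) i k \<in> b \<longrightarrow> b \<notin> M i N)"
    and "\<forall>\<kappa>\<in>PiE I (\<lambda>_. {..<N}). settled I nodes le c (tup (t (Suc N)) \<kappa>)"
    and "\<exists>W. hits W (K N) \<and> (\<forall>n\<in>W. \<forall>\<kappa>\<in>PiE I (\<lambda>_. {..<N}).
        (\<forall>i\<in>I. n \<le> height i (t (Suc N) i (\<kappa> i))) \<and>
        f (slice I T (tup (t (Suc N)) \<kappa>) n) = c (tup (t (Suc N)) \<kappa>))"
  using assms[unfolded fusion_def, THEN conjunct2, THEN spec, of N] by - (erule conjunct1,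
    erule conjunct1[OF conjunct2], erule conjunct2[OF conjunct2])

lemma fusion_step_rel: "fusion c M K t \<Longrightarrow> i \<in> I \<Longrightarrow> (t N i k, t (Suc N) i k) \<in> T i"
  using fusion_stage(1)[THEN bspec, THEN spec, THEN conjunct1] .

lemma fusion_height: "fusion c M K t \<Longrightarrow> i \<in> I \<Longrightarrow> N \<le> height i (t (Suc N) i k)"
  using fusion_stage(1)[THEN bspec, THEN spec, THEN conjunct2, THEN conjunct1] .

lemma fusion_avoids:
  "fusion c M K t \<Longrightarrow> i \<in> I \<Longrightarrow> b \<in> branches (T i) \<Longrightarrow> t (Suc N) i k \<in> b \<Longrightarrow> b \<notin> M i N"
  using fusion_stage(1)[THEN bspec, THEN spec, THEN conjunct2, THEN conjunct2, THEN bspec, THEN mp] .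

lemma fusion_start: "fusion c M K t \<Longrightarrow> i \<in> I \<Longrightarrow> t 0 i k = from_nat_into (nodes i) k"
  unfolding fusion_def by (drule conjunct1) simp

lemma fusion_nodes: "fusion c M K t \<Longrightarrow> i \<in> I \<Longrightarrow> t N i k \<in> nodes i"
  using fusion_step_rel by (rule FieldI1)

lemma fusion_mono:
  assumes "fusion c M K t" "i \<in> I" "m \<le> n"
  shows "(t m i k, t n i k) \<in> T i"
  by (rule omega_tree.sequence_mono[OF trees[OF assms(2)], of "\<lambda>n. t n i k"])
    (rule fusion_step_rel[OF assms(1,2)], rule assms(3))

lemma limit_branch:
  assumes t: "fusion c M K t" and i: "i \<in> I"
  shows "limit_branch t i k \<in> branches (T i)" "t N i k \<in> limit_branch t i k"
proof -
  show "limit_branch t i k \<in> branches (T i)"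
    unfolding limit_branch_def
    by (rule omega_tree.sequence_branch[OF trees[OF i], of "\<lambda>n. t n i k"])
      (rule fusion_step_rel[OF t i], rule exI, rule fusion_height[OF t i])
  show "t N i k \<in> limit_branch t i k"
    unfolding limit_branch_def
    using omega_tree.rel_refl[OF trees[OF i] fusion_nodes[OF t i]] by blast
qed

lemma limit_branch_through:
  assumes t: "fusion c M K t" and i: "i \<in> I" and x: "x \<in> nodes i"
  shows "\<exists>k. x \<in> limit_branch t i k"
proof -
  have "countable (nodes i)" using omega_tree.countable_Field[OF trees[OF i]] .
  then have "from_nat_into (nodes i) (to_nat_on (nodes i) x) = x" using x by simp
  then show ?thesis
    using limit_branch(2)[OF t i, of 0 "to_nat_on (nodes i) x"] fusion_start[OF t i] by auto
qed

lemma tup_mono: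
  assumes t: "fusion c M K t" and mn: "m \<le> n" and s: "settled I nodes le c (tup (t m) \<kappa>)"
  shows "settled I nodes le c (tup (t n) \<kappa>)" "c (tup (t n) \<kappa>) = c (tup (t m) \<kappa>)"
proof -
  have in_B: "tup (t N) \<kappa> \<in> B" for N using tup_in[of "t N"] fusion_nodes[OF t] by blast
  have "le i (tup (t m) \<kappa> i) (tup (t n) \<kappa> i)" if "i \<in> I" for i
    using fusion_mono[OF t that mn] that by (simp add: tup_def tle_def)
  from settled_upward[OF pre in_B s in_B this]
  show "settled I nodes le c (tup (t n) \<kappa>)" "c (tup (t n) \<kappa>) = c (tup (t m) \<kappa>)" by blast+
qed

lemma bounded_index:
  fixes \<kappa> :: "'i \<Rightarrow> nat"
  assumes "\<kappa> \<in> PiE I (\<lambda>_. UNIV)"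
  shows "\<exists>N0. \<forall>N\<ge>N0. \<kappa> \<in> PiE I (\<lambda>_. {..<N})"
proof -
  obtain m where "\<forall>k\<in>\<kappa> ` I. k \<le> m" using finite_nat_set_iff_bounded_le[of "\<kappa> ` I"] fin by blast
  then have "\<forall>N\<ge>Suc m. \<kappa> \<in> PiE I (\<lambda>_. {..<N})" using assms by (auto simp: PiE_iff)
  then show ?thesis by blast
qed

text \<open>As \<open>I\<close> is finite, \<open>\<kappa>\<close> is bounded and its tuple gets
  settled at some stage; later raising leaves the colour unchanged.\<close>

lemma fusion_settled:
  assumes t: "fusion c M K t" and c: "c \<in> B \<rightarrow> A" and \<kappa>: "\<kappa> \<in> PiE I (\<lambda>_. UNIV)"
  shows "\<exists>a\<in>A. \<exists>N0. \<forall>N\<ge>N0. settled I nodes le c (tup (t N) \<kappa>) \<and> c (tup (t N) \<kappa>) = a"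
proof -
  obtain N where "\<kappa> \<in> PiE I (\<lambda>_. {..<N})" using bounded_index[OF \<kappa>] by blast
  then have s: "settled I nodes le c (tup (t (Suc N)) \<kappa>)" using fusion_stage(2)[OF t] by blast
  have "tup (t (Suc N)) \<kappa> \<in> B" using tup_in[of "t (Suc N)"] fusion_nodes[OF t] by blast
  then have "c (tup (t (Suc N)) \<kappa>) \<in> A" using c by (rule funcset_mem[rotated])
  then show ?thesis using tup_mono[OF t _ s] by blast
qed

text \<open>At the levels in \<open>W\<close> the nodes of stage \<open>Suc N\<close> are already
  high enough, so the limit branches have there the same nodes as the stage, and the colours copied
  at that stage persist.\<close>

lemma fusion_levels:
  assumes t: "fusion c M K t"
  shows "\<exists>W. hits W (K N) \<and> (\<forall>n\<in>W. \<forall>\<kappa>\<in>PiE I (\<lambda>_. {..<N}).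
    f (level_tuple (\<lambda>i. limit_branch t i (\<kappa> i)) n) = c (tup (t (Suc N)) \<kappa>))"
proof -
  obtain W where W: "hits W (K N)" "\<forall>n\<in>W. \<forall>\<kappa>\<in>PiE I (\<lambda>_. {..<N}).
      (\<forall>i\<in>I. n \<le> height i (t (Suc N) i (\<kappa> i))) \<and> f (slice I T (tup (t (Suc N)) \<kappa>) n) = c (tup (t (Suc N)) \<kappa>)"
    using fusion_stage(3)[OF t, of N] by (elim exE conjE)
  have "level_tuple (\<lambda>i. limit_branch t i (\<kappa> i)) n = slice I T (tup (t (Suc N)) \<kappa>) n"
    if n: "n \<in> W" and \<kappa>: "\<kappa> \<in> PiE I (\<lambda>_. {..<N})" for n \<kappa>
    unfolding level_tuple_def slice_def
  proof (rule restrict_ext)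
    fix i assume i: "i \<in> I"
    have "n \<le> height i (t (Suc N) i (\<kappa> i))" using W(2) n \<kappa> i by blast
    then show "branch_node (T i) (limit_branch t i (\<kappa> i)) n = omega_tree.anc (T i) (tup (t (Suc N)) \<kappa> i) n"
      using omega_tree.branch_node_eq[OF trees[OF i] limit_branch[OF t i]] i by (simp add: tup_def)
  qed
  with W show ?thesis by (intro exI[of _ W]) simp
qed

text \<open>Branches through the settled nodes of \<open>\<kappa>\<close> have late approximations
  above these nodes, so their final colour is the settled one. This is the source of
  continuity.\<close>

lemma fusion_locally_constant:
  assumes t: "fusion c M K t" and s: "settled I nodes le c (tup (t N) \<kappa>)"
    and s': "\<And>N. N \<ge> N' \<Longrightarrow> c (tup (t N) \<kappa>') = a"
    and near: "\<And>i. i \<in> I \<Longrightarrow> t N i (\<kappa> i) \<in> limit_branch t i (\<kappa>' i)"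
  shows "a = c (tup (t N) \<kappa>)"
proof -
  obtain m where m: "\<forall>h\<in>(\<lambda>i. height i (t N i (\<kappa> i))) ` I. h \<le> m"
    using finite_nat_set_iff_bounded_le[of "(\<lambda>i. height i (t N i (\<kappa> i))) ` I"] fin by blast
  \<comment> \<open>At stage \<open>Suc (max m N')\<close> the heights are at least
    \<open>m\<close>, which bounds the heights of the nodes of \<open>\<kappa>\<close>; on a common
    branch this forces the order. The stage is also late enough for \<open>s'\<close>.\<close>
  let ?N = "Suc (max m N')"
  have in_B: "tup (t N) \<kappa> \<in> B" for N \<kappa> using tup_in[of "t N"] fusion_nodes[OF t] by blast
  have "le i (tup (t N) \<kappa> i) (tup (t ?N) \<kappa>' i)" if i: "i \<in> I" for i
  proof -
    have "height i (t N i (\<kappa> i)) \<le> height i (t ?N i (\<kappa>' i))"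
      using m i fusion_height[OF t i, of "max m N'" "\<kappa>' i"] by fastforce
    then have "(t N i (\<kappa> i), t ?N i (\<kappa>' i)) \<in> T i"
      using omega_tree.branch_ht_le[OF trees[OF i] limit_branch(1)[OF t i] near[OF i] limit_branch(2)[OF t i]] by blast
    then show ?thesis using i by (simp add: tup_def tle_def)
  qed
  from settled_upward(2)[OF pre in_B s in_B this] have "c (tup (t ?N) \<kappa>') = c (tup (t N) \<kappa>)" .
  then show ?thesis using s'[of ?N] by simp
qed

text \<open>\<open>S \<kappa>\<close> contains all but finitely many of the level sets \<open>W N\<close> that the fusion produces, and
  \<open>W N\<close> meets every member of the closed set \<open>K N\<close>.\<close>

lemma limit_filter:
  assumes t: "fusion c M K t" and K: "\<And>n. K n \<subseteq> K (Suc n)" "\<Union> (range K) = {P. eventually P F}"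
    and S: "\<And>\<kappa>. \<kappa> \<in> PiE I (\<lambda>_. UNIV) \<Longrightarrow>
      S \<kappa> = {n. f (level_tuple (\<lambda>i. limit_branch t i (\<kappa> i)) n) = g \<kappa>}"
    and g: "\<And>\<kappa>. \<kappa> \<in> PiE I (\<lambda>_. UNIV) \<Longrightarrow> \<exists>N0. \<forall>N\<ge>N0. c (tup (t N) \<kappa>) = g \<kappa>"
  shows "inf F (INF X\<in>S ` PiE I (\<lambda>_. UNIV). principal X) \<noteq> bot"
proof
  let ?Ks = "PiE I (\<lambda>_. UNIV :: nat set)"
  assume "inf F (INF X\<in>S ` ?Ks. principal X) = bot"
  then have "eventually (\<lambda>_. False) (inf F (INF X\<in>S ` ?Ks. principal X))" by simp
  from this[unfolded eventually_inf_principals]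
  obtain Y E where Y: "eventually Y F" and E: "finite E" "E \<subseteq> S ` ?Ks"
    and disj: "\<forall>n. Y n \<longrightarrow> n \<in> \<Inter>E \<longrightarrow> False"
    by (elim exE conjE)
  from finite_subset_image[OF E] obtain Q where Q: "Q \<subseteq> ?Ks" "finite Q" "E = S ` Q" by (elim exE conjE)
  have "\<exists>N0. \<forall>N\<ge>N0. \<kappa> \<in> PiE I (\<lambda>_. {..<N}) \<and> c (tup (t N) \<kappa>) = g \<kappa>" if \<kappa>: "\<kappa> \<in> ?Ks" for \<kappa>
  proof -
    obtain m n where "\<forall>N\<ge>m. \<kappa> \<in> PiE I (\<lambda>_. {..<N})" "\<forall>N\<ge>n. c (tup (t N) \<kappa>) = g \<kappa>"
      using bounded_index[OF \<kappa>] g[OF \<kappa>] by (elim exE)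
    then show ?thesis by (intro exI[of _ "max m n"]) simp
  qed
  then obtain N0 where N0: "\<And>\<kappa> N. \<kappa> \<in> ?Ks \<Longrightarrow> N0 \<kappa> \<le> N \<Longrightarrow> \<kappa> \<in> PiE I (\<lambda>_. {..<N}) \<and> c (tup (t N) \<kappa>) = g \<kappa>"
    by metis
  obtain m where m: "\<forall>N\<in>N0 ` Q. N \<le> m" using finite_nat_set_iff_bounded_le[of "N0 ` Q"] Q(2) by blast
  obtain l where l: "Y \<in> K l" using Y K(2) by blast
  \<comment> \<open>Late enough for \<open>Y\<close> to lie in \<open>K N\<close> and for every
    index in \<open>Q\<close> to be below \<open>N\<close> with its final colour reached.\<close>
  define N where "N = max m l"
  have "K l \<subseteq> K N" using lift_Suc_mono_le[of K, OF K(1)] by (simp add: N_def)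
  then have YN: "Y \<in> K N" using l by blast
  obtain W where W: "hits W (K N)" "\<forall>n\<in>W. \<forall>\<kappa>\<in>PiE I (\<lambda>_. {..<N}).
      f (level_tuple (\<lambda>i. limit_branch t i (\<kappa> i)) n) = c (tup (t (Suc N)) \<kappa>)"
    using fusion_levels[OF t, of N] by (elim exE conjE)
  obtain n where n: "n \<in> W" "Y n" using W(1) YN unfolding hits_def by blast
  have "n \<in> S \<kappa>" if \<kappa>: "\<kappa> \<in> Q" for \<kappa>
  proof -
    have \<kappa>K: "\<kappa> \<in> ?Ks" and le: "N0 \<kappa> \<le> N" using subsetD[OF Q(1) \<kappa>] bspec[OF m imageI[OF \<kappa>]] by (simp_all add: N_def)
    have "f (level_tuple (\<lambda>i. limit_branch t i (\<kappa> i)) n) = c (tup (t (Suc N)) \<kappa>)"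
      using W(2) n(1) N0[OF \<kappa>K le] by blast
    also have "\<dots> = g \<kappa>" using N0[OF \<kappa>K, of "Suc N"] le by simp
    finally show ?thesis using S[OF \<kappa>K] by simp
  qed
  then show False using disj n(2) Q(3) by blast
qed

lemma continuous_filter_limits:
  fixes M :: "'i \<Rightarrow> nat \<Rightarrow> 'a set set"
  assumes Fs: "fsigma_filter F"
    and nd: "\<forall>N. \<forall>i\<in>I. nowhere_dense_in (branch_topology (T i)) (M i N)"
  shows "\<exists>D F'. (\<forall>i\<in>I. dense_in (branch_topology (T i)) (D i)) \<and>
    fsigma_filter F' \<and> F' \<le> F \<and> (\<forall>i\<in>I. \<forall>N. D i \<inter> M i N = {}) \<and>
    (\<forall>b \<in> PiE I D. \<exists>!a. a \<in> A \<and> eventually (\<lambda>n. f (level_tuple b n) = a) F') \<and>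
    continuous_map (subtopology (product_topology (\<lambda>i. branch_topology (T i)) I) (PiE I D))
      (discrete_topology A) (\<lambda>b. THE a. a \<in> A \<and> eventually (\<lambda>n. f (level_tuple b n) = a) F') \<and>
    (countably_generated_filter F \<longrightarrow> countably_generated_filter F') \<and>
    (\<exists>S. countable S \<and> F' = filter_generated_by ({X. eventually (\<lambda>n. n \<in> X) F} \<union> S))"
proof -
  obtain K :: "nat \<Rightarrow> (nat \<Rightarrow> bool) set" where K: "\<forall>n. closedin cantor (K n)" "\<forall>n. K n \<subseteq> K (Suc n)"
    and KF: "\<Union> (range K) = {P. eventually P F}"
    using Fs[unfolded fsigma_filter_def fsigma_in_ascending] by (elim exE conjE)
  have KF': "K n \<subseteq> {P. eventually P F}" for n using KF by blast
  obtain c where c: "c \<in> B \<rightarrow> A" and real: "\<forall>G. finite G \<longrightarrow> G \<subseteq> B \<longrightarrow> realizes I T f F G c"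
    and dense: "\<forall>s\<in>B. \<exists>t\<in>B. (\<forall>i\<in>I. le i (s i) (t i)) \<and> (\<exists>a. \<forall>x\<in>PiE I (upper_cone nodes le t). c x = a)"
    using generic_colouring by (elim exE conjE)
  obtain t where t: "fusion c M K t"
    using fusion_exists[where K = K, OF real dense nd K(1)[rule_format] KF'] by (elim exE)
  let ?Ks = "PiE I (\<lambda>_. UNIV :: nat set)"
  have "\<forall>\<kappa>\<in>?Ks. \<exists>a N0. a \<in> A \<and> (\<forall>N\<ge>N0. settled I nodes le c (tup (t N) \<kappa>) \<and> c (tup (t N) \<kappa>) = a)"
    using fusion_settled[OF t c] by blast
  then obtain g N0 where g: "\<And>\<kappa>. \<kappa> \<in> ?Ks \<Longrightarrow> g \<kappa> \<in> A"
    and N0: "\<And>\<kappa> N. \<kappa> \<in> ?Ks \<Longrightarrow> N0 \<kappa> \<le> N \<Longrightarrow> settled I nodes le c (tup (t N) \<kappa>) \<and> c (tup (t N) \<kappa>) = g \<kappa>"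
    by metis
  define D where "D i = range (limit_branch t i)" for i
  define S where "S \<kappa> = {n. f (level_tuple (\<lambda>i. limit_branch t i (\<kappa> i)) n) = g \<kappa>}" for \<kappa>
  define F' where "F' = inf F (INF X\<in>S ` ?Ks. principal X)"
  have countS: "countable (S ` ?Ks)" using fin by (intro countable_image countable_PiE) auto
  have ne: "F' \<noteq> bot"
    unfolding F'_def
  proof (rule limit_filter[OF t K(2)[rule_format] KF])
    show "\<exists>N0. \<forall>N\<ge>N0. c (tup (t N) \<kappa>) = g \<kappa>" if "\<kappa> \<in> ?Ks" for \<kappa>
      using N0[OF that] by (intro exI[of _ "N0 \<kappa>"]) blast
  qed (rule S_def)
  have rep: "\<exists>\<kappa>\<in>?Ks. (\<forall>i\<in>I. b i = limit_branch t i (\<kappa> i))" if b: "b \<in> PiE I D" for b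
  proof -
    have "\<forall>i\<in>I. \<exists>k. b i = limit_branch t i k" using PiE_mem[OF b] unfolding D_def by blast
    then obtain \<kappa> where "\<forall>i\<in>I. b i = limit_branch t i (\<kappa> i)" by metis
    then show ?thesis by (intro bexI[of _ "restrict \<kappa> I"]) auto
  qed
  have lim: "eventually (\<lambda>n. f (level_tuple b n) = g \<kappa>) F'"
    if \<kappa>: "\<kappa> \<in> ?Ks" and b: "\<forall>i\<in>I. b i = limit_branch t i (\<kappa> i)" for b \<kappa>
  proof -
    have "level_tuple b n = level_tuple (\<lambda>i. limit_branch t i (\<kappa> i)) n" for n
      unfolding level_tuple_def using b by (intro restrict_ext) simp
    then have "S \<kappa> = {n. f (level_tuple b n) = g \<kappa>}" unfolding S_def by simp
    moreover have "F' \<le> principal (S \<kappa>)"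
      unfolding F'_def using \<kappa> by (intro le_infI2 INF_lower) blast
    ultimately show ?thesis by (simp add: le_principal)
  qed
  have uniq: "a = a'" if "eventually (\<lambda>n. f (level_tuple b n) = a) F'" "eventually (\<lambda>n. f (level_tuple b n) = a') F'" for a a' b
  proof -
    have "eventually (\<lambda>n. a = a') F'" using that by eventually_elim simp
    then show ?thesis using ne by (simp add: eventually_const)
  qed
  define L where "L b = (THE a. a \<in> A \<and> eventually (\<lambda>n. f (level_tuple b n) = a) F')" for b
  \<comment> \<open>Different indices may describe the same branches. Since \<open>F'\<close> is
    proper, limits along it are unique, so \<open>g \<kappa>\<close> depends on the branches
    only.\<close>
  have L: "L b = g \<kappa>" if "\<kappa> \<in> ?Ks" "\<forall>i\<in>I. b i = limit_branch t i (\<kappa> i)" for b \<kappa>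
    unfolding L_def using g[OF that(1)] lim[OF that] uniq by (intro the_equality) blast+
  let ?X = "product_topology (\<lambda>i. branch_topology (T i)) I"
  have Dsub: "D i \<subseteq> branches (T i)" if "i \<in> I" for i
    using limit_branch(1)[OF t that] unfolding D_def by blast
  have "continuous_map (subtopology ?X (PiE I D)) (discrete_topology A) L"
    unfolding continuous_map_def
  proof (intro conjI allI impI funcsetI)
    fix b assume "b \<in> topspace (subtopology ?X (PiE I D))"
    then have "b \<in> PiE I D" by simp
    from rep[OF this] obtain \<kappa> where \<kappa>: "\<kappa> \<in> ?Ks" "\<forall>i\<in>I. b i = limit_branch t i (\<kappa> i)" by (elim bexE)
    then show "L b \<in> topspace (discrete_topology A)" using L[OF \<kappa>] g by simp
  next
    fix U
    let ?V = "{b \<in> topspace (subtopology ?X (PiE I D)). L b \<in> U}"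
    show "openin (subtopology ?X (PiE I D)) ?V"
    proof (subst openin_subopen, rule ballI)
      fix b assume "b \<in> ?V"
      then have b: "b \<in> PiE I D" "L b \<in> U" by simp_all
      obtain \<kappa> where \<kappa>: "\<kappa> \<in> ?Ks" "\<forall>i\<in>I. b i = limit_branch t i (\<kappa> i)" using rep[OF b(1)] by (elim bexE)
      \<comment> \<open>The basic neighbourhood given by the nodes of \<open>\<kappa>\<close> at a
        stage where their tuple is settled: all tuples from \<open>D\<close> in it share one limit
        colour.\<close>
      define V where "V = PiE I (\<lambda>i. {b' \<in> branches (T i). t (N0 \<kappa>) i (\<kappa> i) \<in> b'})"
      have openV: "openin ?X V"
        unfolding V_def using omega_tree.openin_node[OF trees fusion_nodes[OF t]] fin
        by (intro openin_PiE_gen[THEN iffD2]) auto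
      have bV: "b \<in> V"
        unfolding V_def using b(1) \<kappa>(2) limit_branch[OF t] by (auto simp: PiE_iff)
      have "L b' \<in> U" if b': "b' \<in> PiE I D" "b' \<in> V" for b'
      proof -
        obtain \<kappa>' where \<kappa>': "\<kappa>' \<in> ?Ks" "\<forall>i\<in>I. b' i = limit_branch t i (\<kappa>' i)" using rep[OF b'(1)] by (elim bexE)
        have near: "t (N0 \<kappa>) i (\<kappa> i) \<in> limit_branch t i (\<kappa>' i)" if i: "i \<in> I" for i
          using PiE_mem[OF b'(2)[unfolded V_def] i] \<kappa>'(2) i by simp
        have s: "settled I nodes le c (tup (t (N0 \<kappa>)) \<kappa>)" "c (tup (t (N0 \<kappa>)) \<kappa>) = g \<kappa>"
          using N0[OF \<kappa>(1), of "N0 \<kappa>"] by simp_all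
        have "g \<kappa>' = c (tup (t (N0 \<kappa>)) \<kappa>)"
          using N0[OF \<kappa>'(1)] by (intro fusion_locally_constant[OF t s(1), of "N0 \<kappa>'" \<kappa>' "g \<kappa>'"] near) blast+
        then show ?thesis using L[OF \<kappa>] L[OF \<kappa>'] s(2) b(2) by simp
      qed
      then have "V \<inter> PiE I D \<subseteq> ?V" using openin_subset[OF openV] by auto
      moreover have "openin (subtopology ?X (PiE I D)) (V \<inter> PiE I D)"
        using openV by (rule openin_subtopology_Int)
      ultimately show "\<exists>W. openin (subtopology ?X (PiE I D)) W \<and> b \<in> W \<and> W \<subseteq> ?V"
        using bV b(1) by blast
    qed
  qed
  moreover have "\<forall>i\<in>I. dense_in (branch_topology (T i)) (D i)"
  proof
    fix i assume i: "i \<in> I"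
    show "dense_in (branch_topology (T i)) (D i)"
      using limit_branch_through[OF t i] by (intro omega_tree.dense_inI[OF trees[OF i] Dsub[OF i]]) (auto simp: D_def)
  qed
  moreover have "\<forall>i\<in>I. \<forall>N. D i \<inter> M i N = {}"
    using fusion_avoids[OF t] limit_branch[OF t] unfolding D_def by blast
  moreover have "\<forall>b \<in> PiE I D. \<exists>!a. a \<in> A \<and> eventually (\<lambda>n. f (level_tuple b n) = a) F'"
  proof
    fix b assume "b \<in> PiE I D"
    from rep[OF this] obtain \<kappa> where \<kappa>: "\<kappa> \<in> ?Ks" "\<forall>i\<in>I. b i = limit_branch t i (\<kappa> i)" by (elim bexE)
    show "\<exists>!a. a \<in> A \<and> eventually (\<lambda>n. f (level_tuple b n) = a) F'"
      using g[OF \<kappa>(1)] lim[OF \<kappa>] uniq by (intro ex1I[of _ "g \<kappa>"]) blast+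
  qed
  moreover have "fsigma_filter F'"
    using fsigma_filter_inf_principals[OF Fs countS ne[unfolded F'_def]] unfolding F'_def .
  moreover have "F' \<le> F" unfolding F'_def by simp
  moreover have "countably_generated_filter F \<longrightarrow> countably_generated_filter F'"
    unfolding F'_def using countably_generated_inf_principals[OF _ countS] by blast
  moreover have "F' = filter_generated_by ({X. eventually (\<lambda>n. n \<in> X) F} \<union> S ` ?Ks)"
    unfolding F'_def filter_generated_by_Un ..
  ultimately show ?thesis
    unfolding L_def using countS by (intro exI[of _ D] exI[of _ F'] conjI) blast+
qed

end

theorem theorem9:
  fixes d :: nat
    and T :: "nat \<Rightarrow> 'a rel"
    and A :: "'c set"
    and f :: "(nat \<Rightarrow> 'a) \<Rightarrow> 'c"
    and F0 :: "nat filter"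
    and M :: "nat \<Rightarrow> 'a set set"
  assumes "d \<ge> 1"
    and "\<And>i. i \<in> {1..d} \<Longrightarrow> rooted_omega_tree (T i)"
    and "\<And>i. i \<in> {1..d} \<Longrightarrow> no_isolated_branches (T i)"
    and "\<And>i x. i \<in> {1..d} \<Longrightarrow> x \<in> Field (T i) \<Longrightarrow>
           immediate_successors (T i) x \<noteq> {} \<and> countable (immediate_successors (T i) x)"
    and "finite A"
    and "f \<in> (\<Union>l. \<Pi>\<^sub>E i\<in>{1..d}. tree_level (T i) l) \<rightarrow> A"
    and "fsigma_filter F0"
    and "\<And>i. i \<in> {1..d} \<Longrightarrow> first_category_in (branch_topology (T i)) (M i)"
  shows "\<exists>(D :: nat \<Rightarrow> 'a set set) (F :: nat filter).
           (\<forall>i\<in>{1..d}. dense_in (branch_topology (T i)) (D i)) \<and>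
           fsigma_filter F \<and> F \<le> F0 \<and>
           (\<forall>i\<in>{1..d}. D i \<inter> M i = {}) \<and>
           (\<forall>b \<in> (\<Pi>\<^sub>E i\<in>{1..d}. D i). \<exists>!a. a \<in> A \<and>
              eventually (\<lambda>n. f (\<lambda>i\<in>{1..d}. branch_node (T i) (b i) n) = a) F) \<and>
           continuous_map
             (subtopology (product_topology (\<lambda>i. branch_topology (T i)) {1..d})
                (\<Pi>\<^sub>E i\<in>{1..d}. D i))
             (discrete_topology A)
             (\<lambda>b. THE a. a \<in> A \<and>
                eventually (\<lambda>n. f (\<lambda>i\<in>{1..d}. branch_node (T i) (b i) n) = a) F) \<and>
           (countably_generated_filter F0 \<longrightarrow> countably_generated_filter F) \<and>
           (\<exists>S. countable S \<and>
              F = filter_generated_by ({X. eventually (\<lambda>n. n \<in> X) F0} \<union> S))"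
proof -
  have "\<forall>i\<in>{1..d}. \<exists>N :: nat \<Rightarrow> 'a set set. (\<forall>n. nowhere_dense_in (branch_topology (T i)) (N n)) \<and> M i = (\<Union>n. N n)"
    using assms(8) unfolding first_category_in_def by blast
  then obtain N :: "nat \<Rightarrow> nat \<Rightarrow> 'a set set" where
    N: "\<forall>i\<in>{1..d}. (\<forall>n. nowhere_dense_in (branch_topology (T i)) (N i n)) \<and> M i = (\<Union>n. N i n)"
    by metis
  interpret tree_family "{1..d}" T A f F0
  proof
    fix i assume i: "i \<in> {1..d}"
    show "rooted_omega_tree (T i)" using assms(2)[OF i] .
    show "immediate_successors (T i) x \<noteq> {} \<and> countable (immediate_successors (T i) x)" if "x \<in> Field (T i)" for x
      using assms(4)[OF i that] .
  next
    show "F0 \<noteq> bot" using assms(7) unfolding fsigma_filter_def by blast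
  qed (use assms(5,6) in auto)
  have nd: "\<forall>n. \<forall>i\<in>{1..d}. nowhere_dense_in (branch_topology (T i)) (N i n)" using N by blast
  obtain D F S where DF: "\<forall>i\<in>{1..d}. dense_in (branch_topology (T i)) (D i)"
    "fsigma_filter F" "F \<le> F0" "\<forall>i\<in>{1..d}. \<forall>n. D i \<inter> N i n = {}"
    "\<forall>b \<in> PiE {1..d} D. \<exists>!a. a \<in> A \<and> eventually (\<lambda>n. f (level_tuple b n) = a) F"
    "continuous_map (subtopology (product_topology (\<lambda>i. branch_topology (T i)) {1..d}) (PiE {1..d} D))
      (discrete_topology A) (\<lambda>b. THE a. a \<in> A \<and> eventually (\<lambda>n. f (level_tuple b n) = a) F)"
    "countably_generated_filter F0 \<longrightarrow> countably_generated_filter F"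
    "countable S" "F = filter_generated_by ({X. eventually (\<lambda>n. n \<in> X) F0} \<union> S)"
    using continuous_filter_limits[OF assms(7) nd] by (elim exE conjE)
  have "\<forall>i\<in>{1..d}. D i \<inter> M i = {}" using DF(4) N by blast
  with DF(1-3) DF(5-9)[unfolded level_tuple_def] show ?thesis
    by (intro exI[of _ D] exI[of _ F] exI[of _ S] conjI)
qed

end
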